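(* Let $\Omega=\mathbb R^d$, $q\equiv0$ and $a\equiv1$. For $j\in\{0,1,2\}$ set $\mathfrak c_j=\left(\sup_{s\ge0}s^{j+1}e^{-2s}\right)^{1/2}=\left(\frac{j+1}{2e}\right)^{\frac{j+1}2}$. Let $\rho_0,\rho_1,\rho_2:\mathbb R_+\to\mathbb R_+$ be such that for all $F=(f,g)\in\mathcal K$ and all $t>0$ the (mild) solution $u(t)$ of $\partial_{tt}u+\partial_tu=\Delta u$ on $\mathbb R^d$ with $(u(0),\partial_tu(0))=(f,g)$ satisfies $$\|u(t)\|_{L^2}\le\rho_0(t)\|F\|_{\mathcal K},\qquad \|\nabla u(t)\|_{L^2}\le\rho_1(t)\|F\|_{\mathcal K},\qquad \|\partial_tu(t)\|_{L^2}\le\rho_2(t)\|F\|_{\mathcal K}.$$ Then for every $\varepsilon>0$ there exists $t_0\ge1$ such that for all $t\ge t_0$ $$\rho_0(t)\ge\frac{\mathfrak c_0-\varepsilon}{\sqrt t},\qquad \rho_1(t)\ge\frac{\mathfrak c_1-\varepsilon}{t},\qquad \rho_2(t)\ge\frac{\mathfrak c_2-\varepsilon}{t^{3/2}}.$$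
   Context: $\mathcal W$ is the Hilbert completion of $C_c^\infty(\mathbb R^d)$ with respect to the norm $\|u\|_{\mathcal W}=\|\nabla u\|_{L^2}$; $\mathcal W^*$ is the space of bounded antilinear functionals on $\mathcal W$ with the dual norm; $\mathcal H=\mathcal W\oplus L^2(\mathbb R^d)$ with $\|(f,g)\|_{\mathcal H}^2=\|f\|_{\mathcal W}^2+\|g\|_{L^2}^2$. The space $H^1(\mathbb R^d)$ is boundedly embedded in $\mathcal W$ and $\Delta:\mathcal W\to\mathcal W^*$ is given by $(\Delta u,v)=-\langle\nabla u,\nabla v\rangle_{L^2}$. The operator $\mathcal A(f,g)=(g,\Delta f-g)$ with $\mathrm{Dom}(\mathcal A)=\{(f,g)\in\mathcal W\times H^1(\mathbb R^d):\Delta f-g\in L^2(\mathbb R^d)\}$ generates a $C_0$-contraction semigroup on $\mathcal H$; the (mild) solution for $F=(f,g)\in\mathcal H$ is the first component $u(t)$ of $e^{t\mathcal A}F=(u(t),\partial_tu(t))$. The space of initial data is $$\mathcal K=\{(f,g)\in H^1(\mathbb R^d)\times L^2(\mathbb R^d): f+g\in\mathcal W^*\},\qquad \|(f,g)\|_{\mathcal K}^2=\|(f,g)\|_{\mathcal H}^2+\|f\|_{L^2}^2+\|f+g\|_{\mathcal W^*}^2,$$ where $f+g\in\mathcal W^*$ means that $\varphi\mapsto\int_{\mathbb R^d}(f+g)\overline\varphi\,dx$ on $C_c^\infty(\mathbb R^d)$ extends to a bounded functional on $\mathcal W$. *)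

theory Defs
  imports "HOL-Analysis.Analysis"
begin

section \<open>Complex scalar multiplication\<close>

class scaleC =
  fixes scaleC :: "complex \<Rightarrow> 'a \<Rightarrow> 'a" (infixr "*\<^sub>C" 75)

instantiation vec :: (scaleC, finite) scaleC
begin
definition "scaleC c v = (\<chi> i. c *\<^sub>C (v $ i))" for v :: "('a, 'b) vec"
instance ..
end

instantiation prod :: (scaleC, scaleC) scaleC
begin
definition "scaleC c p = (c *\<^sub>C fst p, c *\<^sub>C snd p)" for p :: "'a \<times> 'b"
instance ..
end


section \<open>The space $L^2$ of complex-valued functions modulo null sets\<close>

definition square_integrable :: "('a::euclidean_space \<Rightarrow> complex) \<Rightarrow> bool" where
  "square_integrable f \<longleftrightarrow>
     f \<in> borel_measurable lborel \<and> integrable lborel (\<lambda>x. (cmod (f x))\<^sup>2)"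

lemma square_integrable_measurable:
  "square_integrable f \<Longrightarrow> f \<in> borel_measurable lborel"
  by (simp add: square_integrable_def)

lemma square_integrable_mult_cnj:
  assumes "square_integrable f" "square_integrable g"
  shows "integrable lborel (\<lambda>x. f x * cnj (g x))"
proof (rule Bochner_Integration.integrable_bound)
  show "integrable lborel (\<lambda>x. (cmod (f x))\<^sup>2 + (cmod (g x))\<^sup>2)"
    using assms by (auto simp: square_integrable_def)
  have [measurable]: "f \<in> borel_measurable lborel" "g \<in> borel_measurable lborel"
    using assms by (auto simp: square_integrable_def)
  have [measurable]: "(\<lambda>x. cnj (g x)) \<in> borel_measurable lborel"
    by (rule borel_measurable_continuous_on[of cnj]) (auto intro!: continuous_intros)
  show "(\<lambda>x. f x * cnj (g x)) \<in> borel_measurable lborel"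
    by measurable
  have "cmod (f x * cnj (g x)) \<le> (cmod (f x))\<^sup>2 + (cmod (g x))\<^sup>2" for x
  proof -
    have "2 * (cmod (f x) * cmod (g x)) \<le> (cmod (f x))\<^sup>2 + (cmod (g x))\<^sup>2"
      using sum_squares_bound[of "cmod (f x)" "cmod (g x)"] by (simp add: algebra_simps)
    moreover have "0 \<le> cmod (f x) * cmod (g x)" by simp
    ultimately have "cmod (f x) * cmod (g x) \<le> (cmod (f x))\<^sup>2 + (cmod (g x))\<^sup>2"
      by linarith
    then show ?thesis by (simp add: norm_mult)
  qed
  then show "AE x in lborel. norm (f x * cnj (g x)) \<le> norm ((cmod (f x))\<^sup>2 + (cmod (g x))\<^sup>2)"
    by auto
qed

lemma square_integrable_inner:
  assumes "square_integrable f" "square_integrable g"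
  shows "integrable lborel (\<lambda>x. f x \<bullet> g x)"
proof -
  have "integrable lborel (\<lambda>x. Re (f x * cnj (g x)))"
    using square_integrable_mult_cnj[OF assms] by (rule integrable_Re)
  then show ?thesis by (simp add: inner_complex_def)
qed

lemma square_integrable_0: "square_integrable (\<lambda>x. 0)"
  by (simp add: square_integrable_def)

lemma square_integrable_cmult:
  assumes "square_integrable f"
  shows "square_integrable (\<lambda>x. c * f x)"
  using assms by (auto simp: square_integrable_def norm_mult power_mult_distrib)

lemma square_integrable_add:
  assumes "square_integrable f" "square_integrable g"
  shows "square_integrable (\<lambda>x. f x + g x)"
proof -
  have eq: "(cmod (f x + g x))\<^sup>2 = (cmod (f x))\<^sup>2 + 2 * (f x \<bullet> g x) + (cmod (g x))\<^sup>2" for x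
    by (simp add: power2_norm_eq_inner inner_add_left inner_add_right inner_commute)
  show ?thesis
    using assms square_integrable_inner[OF assms] unfolding square_integrable_def eq by auto
qed

lemma square_integrable_uminus:
  "square_integrable f \<Longrightarrow> square_integrable (\<lambda>x. - f x)"
  by (auto simp: square_integrable_def)

lemma square_integrable_diff:
  "square_integrable f \<Longrightarrow> square_integrable g \<Longrightarrow> square_integrable (\<lambda>x. f x - g x)"
  using square_integrable_add[OF _ square_integrable_uminus, of f g] by simp

lemma square_integrable_scaleR:
  "square_integrable f \<Longrightarrow> square_integrable (\<lambda>x. r *\<^sub>R f x)"
  using square_integrable_cmult[of f "of_real r"] by (simp add: scaleR_conv_of_real)

definition l2rel :: "('a::euclidean_space \<Rightarrow> complex) \<Rightarrow> ('a \<Rightarrow> complex) \<Rightarrow> bool" where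
  "l2rel f g \<longleftrightarrow> square_integrable f \<and> square_integrable g \<and> (AE x in lborel. f x = g x)"

lemma part_equivp_l2rel: "part_equivp l2rel"
proof (rule part_equivpI)
  show "\<exists>f::'a \<Rightarrow> complex. l2rel f f"
    using square_integrable_0 by (auto simp: l2rel_def)
  show "symp l2rel"
    by (auto simp: l2rel_def symp_def)
  show "transp l2rel"
    unfolding l2rel_def transp_def by (auto elim: AE_mp)
qed

quotient_type (overloaded) 'a l2 = "'a::euclidean_space \<Rightarrow> complex" / partial: l2rel
  by (rule part_equivp_l2rel)

instantiation l2 :: (euclidean_space) "{real_vector, scaleC}"
begin

lift_definition zero_l2 :: "'a l2" is "\<lambda>x. 0"
  by (simp add: l2rel_def square_integrable_0)

lift_definition plus_l2 :: "'a l2 \<Rightarrow> 'a l2 \<Rightarrow> 'a l2" is "\<lambda>f g x. f x + g x"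
  by (auto simp: l2rel_def square_integrable_add)

lift_definition uminus_l2 :: "'a l2 \<Rightarrow> 'a l2" is "\<lambda>f x. - f x"
  by (auto simp: l2rel_def square_integrable_uminus)

lift_definition minus_l2 :: "'a l2 \<Rightarrow> 'a l2 \<Rightarrow> 'a l2" is "\<lambda>f g x. f x - g x"
  by (auto simp: l2rel_def square_integrable_diff)

lift_definition scaleR_l2 :: "real \<Rightarrow> 'a l2 \<Rightarrow> 'a l2" is "\<lambda>r f x. r *\<^sub>R f x"
  by (auto simp: l2rel_def square_integrable_scaleR)

lift_definition scaleC_l2 :: "complex \<Rightarrow> 'a l2 \<Rightarrow> 'a l2" is "\<lambda>c f x. c * f x"
  by (auto simp: l2rel_def square_integrable_cmult)

instance
proof
  fix a b c :: "'a l2" and r s :: real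
  show "a + b + c = a + (b + c)"
    by transfer (auto simp: l2rel_def add.assoc intro!: square_integrable_add)
  show "a + b = b + a"
    by transfer (auto simp: l2rel_def add.commute intro!: square_integrable_add)
  show "0 + a = a"
    by transfer (auto simp: l2rel_def)
  show "- a + a = 0"
    by transfer (auto simp: l2rel_def square_integrable_0)
  show "a - b = a + - b"
    by transfer (auto simp: l2rel_def square_integrable_diff)
  show "r *\<^sub>R (a + b) = r *\<^sub>R a + r *\<^sub>R b"
    by transfer (auto simp: l2rel_def scaleR_add_right
        intro!: square_integrable_add square_integrable_scaleR)
  show "(r + s) *\<^sub>R a = r *\<^sub>R a + s *\<^sub>R a"
    by transfer (auto simp: l2rel_def scaleR_add_left
        intro!: square_integrable_add square_integrable_scaleR)
  show "r *\<^sub>R s *\<^sub>R a = (r * s) *\<^sub>R a"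
    by transfer (auto simp: l2rel_def intro!: square_integrable_scaleR)
  show "1 *\<^sub>R a = a"
    by transfer (auto simp: l2rel_def)
qed

end

lift_definition cinner_l2 :: "'a::euclidean_space l2 \<Rightarrow> 'a l2 \<Rightarrow> complex" is
  "\<lambda>f g. \<integral>x. f x * cnj (g x) \<partial>lborel"
proof -
  fix f f' g g' :: "'a \<Rightarrow> complex"
  assume "l2rel f f'" "l2rel g g'"
  then have *: "square_integrable f" "square_integrable f'" "square_integrable g"
      "square_integrable g'" and ae: "AE x in lborel. f x = f' x" "AE x in lborel. g x = g' x"
    by (auto simp: l2rel_def)
  show "(\<integral>x. f x * cnj (g x) \<partial>lborel) = (\<integral>x. f' x * cnj (g' x) \<partial>lborel)"
  proof (rule integral_cong_AE)
    show "(\<lambda>x. f x * cnj (g x)) \<in> borel_measurable lborel"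
      "(\<lambda>x. f' x * cnj (g' x)) \<in> borel_measurable lborel"
      by (rule borel_measurable_integrable[OF square_integrable_mult_cnj]; fact *)+
    show "AE x in lborel. f x * cnj (g x) = f' x * cnj (g' x)"
      using ae by eventually_elim simp
  qed
qed

lemma cinner_l2_add_left: "cinner_l2 (f + g) h = cinner_l2 f h + cinner_l2 g h"
proof (transfer, goal_cases)
  case (1 f g h)
  then have *: "integrable lborel (\<lambda>x. f x * cnj (h x))" "integrable lborel (\<lambda>x. g x * cnj (h x))"
    by (auto simp: l2rel_def square_integrable_mult_cnj)
  show ?case
    unfolding ring_distribs using * by (rule Bochner_Integration.integral_add)
qed

lemma cinner_l2_scaleC_left: "cinner_l2 (c *\<^sub>C f) h = c * cinner_l2 f h"
  by transfer (simp add: mult.assoc)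

lemma scaleR_l2_eq_scaleC: "r *\<^sub>R f = complex_of_real r *\<^sub>C (f :: 'a::euclidean_space l2)"
  by transfer (auto simp: l2rel_def scaleR_conv_of_real intro!: square_integrable_cmult)

lemma cinner_l2_commute: "cinner_l2 g f = cnj (cinner_l2 f g)"
proof (transfer, goal_cases)
  case (1 g f)
  have "(\<lambda>x. g x * cnj (f x)) = (\<lambda>x. cnj (f x * cnj (g x)))"
    by (auto simp: mult.commute)
  then show ?case
    by (simp only: Bochner_Integration.integral_cnj)
qed

lemma cinner_l2_self:
  "cinner_l2 f f = complex_of_real (\<integral>x. (cmod (rep_l2 f x))\<^sup>2 \<partial>lborel)"
proof -
  have "l2rel (rep_l2 f) (rep_l2 f)"
    using Quotient3_rel_rep[OF Quotient3_l2] by fast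
  then have "cinner_l2 f f = (\<integral>x. rep_l2 f x * cnj (rep_l2 f x) \<partial>lborel)"
    using cinner_l2.abs_eq[of "rep_l2 f" "rep_l2 f"] Quotient3_abs_rep[OF Quotient3_l2, of f] by simp
  then show ?thesis
    by (simp only: complex_norm_square[symmetric] integral_complex_of_real)
qed

instantiation l2 :: (euclidean_space) real_inner
begin

definition inner_l2 :: "'a l2 \<Rightarrow> 'a l2 \<Rightarrow> real" where
  "inner_l2 f g = Re (cinner_l2 f g)"

definition norm_l2 :: "'a l2 \<Rightarrow> real" where "norm_l2 f = sqrt (f \<bullet> f)"
definition dist_l2 :: "'a l2 \<Rightarrow> 'a l2 \<Rightarrow> real" where "dist_l2 f g = norm (f - g)"
definition sgn_l2 :: "'a l2 \<Rightarrow> 'a l2" where "sgn_l2 f = f /\<^sub>R norm f"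
definition uniformity_l2 :: "('a l2 \<times> 'a l2) filter" where
  "uniformity_l2 = (INF e\<in>{0<..}. principal {(f, g). dist f g < e})"
definition open_l2 :: "'a l2 set \<Rightarrow> bool" where
  "open_l2 U \<longleftrightarrow> (\<forall>x\<in>U. \<forall>\<^sub>F (x', y) in uniformity. x' = x \<longrightarrow> y \<in> U)"

instance
proof
  fix f g h :: "'a l2" and r :: real and U :: "'a l2 set"
  show "dist f g = norm (f - g)" by (rule dist_l2_def)
  show "sgn f = f /\<^sub>R norm f" by (rule sgn_l2_def)
  show "uniformity = (INF e\<in>{0<..}. principal {(f, g :: 'a l2). dist f g < e})"
    by (rule uniformity_l2_def)
  show "open U \<longleftrightarrow> (\<forall>x\<in>U. \<forall>\<^sub>F (x', y) in uniformity. x' = x \<longrightarrow> y \<in> U)"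
    by (rule open_l2_def)
  show "f \<bullet> g = g \<bullet> f"
    using cinner_l2_commute[of f g] by (simp add: inner_l2_def)
  show "(f + g) \<bullet> h = f \<bullet> h + g \<bullet> h"
    by (simp add: inner_l2_def cinner_l2_add_left)
  show "r *\<^sub>R f \<bullet> g = r * (f \<bullet> g)"
    by (simp add: inner_l2_def scaleR_l2_eq_scaleC cinner_l2_scaleC_left)
  show "0 \<le> f \<bullet> f"
    by (simp add: inner_l2_def cinner_l2_self)
  show "f \<bullet> f = 0 \<longleftrightarrow> f = 0"
  proof
    assume "f = 0"
    then show "f \<bullet> f = 0"
      using cinner_l2_add_left[of 0 0 f] by (simp add: inner_l2_def)
  next
    assume "f \<bullet> f = 0"
    then have "Re (cinner_l2 f f) = 0" by (simp add: inner_l2_def)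
    then show "f = 0"
    proof (transfer, goal_cases)
      case (1 f)
      then have sq: "square_integrable f" by (simp add: l2rel_def)
      have "integrable lborel (\<lambda>x. complex_of_real ((cmod (f x))\<^sup>2))"
        using sq by (intro integrable_of_real) (simp add: square_integrable_def)
      moreover have "Re (\<integral>x. complex_of_real ((cmod (f x))\<^sup>2) \<partial>lborel) = 0"
        using 1(2) by (simp only: complex_norm_square)
      ultimately have "(\<integral>x. (cmod (f x))\<^sup>2 \<partial>lborel) = 0"
        by (simp only: integral_complex_of_real Re_complex_of_real)
      then have "AE x in lborel. (cmod (f x))\<^sup>2 = 0"
        using sq by (subst (asm) integral_nonneg_eq_0_iff_AE) (auto simp: square_integrable_def)
      then show ?case
        using sq square_integrable_0 by (auto simp: l2rel_def)
    qed
  qed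
  show "norm f = sqrt (f \<bullet> f)" by (rule norm_l2_def)
qed

end

lemma norm_abs_l2:
  assumes "square_integrable f"
  shows "(norm (abs_l2 f))\<^sup>2 = (\<integral>x. (cmod (f x))\<^sup>2 \<partial>lborel)"
proof -
  have "l2rel f f" using assms by (simp add: l2rel_def)
  then have "cinner_l2 (abs_l2 f) (abs_l2 f) = (\<integral>x. f x * cnj (f x) \<partial>lborel)"
    by (simp add: cinner_l2.abs_eq)
  then have "cinner_l2 (abs_l2 f) (abs_l2 f) = complex_of_real (\<integral>x. (cmod (f x))\<^sup>2 \<partial>lborel)"
    by (simp only: complex_norm_square[symmetric] integral_complex_of_real)
  then show ?thesis
    by (simp add: power2_norm_eq_inner inner_l2_def)
qed

lemma square_integrable_rep_l2: "square_integrable (rep_l2 f)"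
  using Quotient3_rel_rep[OF Quotient3_l2, of f f] by (simp add: l2rel_def)

lemma abs_rep_l2: "abs_l2 (rep_l2 f) = f"
  by (rule Quotient3_abs_rep[OF Quotient3_l2])

lemma abs_l2_diff:
  assumes "square_integrable f" "square_integrable g"
  shows "abs_l2 f - abs_l2 g = abs_l2 (\<lambda>x. f x - g x)"
  using assms by (intro minus_l2.abs_eq) (auto simp: l2rel_def)

lemma nn_integral_l2_dist:
  "(\<integral>\<^sup>+x. ennreal ((cmod (rep_l2 f x - rep_l2 g x))\<^sup>2) \<partial>lborel) = ennreal ((dist f g)\<^sup>2)"
proof -
  let ?h = "\<lambda>x. rep_l2 f x - rep_l2 g x"
  have sq: "square_integrable ?h"
    by (intro square_integrable_diff square_integrable_rep_l2)
  have "abs_l2 ?h = f - g"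
    using abs_l2_diff[OF square_integrable_rep_l2 square_integrable_rep_l2, of f g]
    by (simp add: abs_rep_l2)
  then have "(dist f g)\<^sup>2 = (\<integral>x. (cmod (?h x))\<^sup>2 \<partial>lborel)"
    using norm_abs_l2[OF sq] by (simp add: dist_norm)
  then show ?thesis
    using sq by (simp add: nn_integral_eq_integral square_integrable_def)
qed

lemma convergent_if_weighted_suminf_finite:
  fixes u :: "nat \<Rightarrow> complex"
  assumes "(\<Sum>k. ennreal (8 ^ k * (cmod (u (Suc k) - u k))\<^sup>2)) \<noteq> \<infinity>"
  shows "convergent u"
proof -
  define a where "a = (\<lambda>k. ennreal (8 ^ k * (cmod (u (Suc k) - u k))\<^sup>2))"
  define S where "S = suminf a"
  obtain C where C: "S = ennreal C" "C \<ge> 0"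
    using assms unfolding a_def[symmetric] S_def[symmetric] by (cases S) (auto simp only: infinity_ennreal_def)
  have bd: "cmod (u (Suc k) - u k) \<le> sqrt C * (1 / sqrt 8) ^ k" for k
  proof -
    have "sum a {k} \<le> S"
      unfolding S_def by (rule sum_le_suminf) auto
    then have "a k \<le> ennreal C" using C(1) by simp
    then have "8 ^ k * (cmod (u (Suc k) - u k))\<^sup>2 \<le> C"
      unfolding a_def ennreal_le_iff[OF C(2)] .
    then have "(cmod (u (Suc k) - u k))\<^sup>2 \<le> C / 8 ^ k"
      by (simp add: pos_le_divide_eq mult.commute)
    then have "cmod (u (Suc k) - u k) \<le> sqrt (C / 8 ^ k)"
      by (rule real_le_rsqrt)
    then show ?thesis
      by (simp only: real_sqrt_divide real_sqrt_power power_divide real_sqrt_one power_one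
          times_divide_eq_right mult_1_right)
  qed
  have s: "summable (\<lambda>k. sqrt C * (1 / sqrt 8) ^ k)"
    by (intro summable_mult summable_geometric) simp
  have "summable (\<lambda>k. u (Suc k) - u k)"
    by (rule summable_comparison_test'[OF s]) (rule bd)
  then have "convergent (\<lambda>n. \<Sum>k<n. u (Suc k) - u k)"
    by (simp only: summable_iff_convergent)
  then have "convergent (\<lambda>n. u n - u 0)"
    by (simp only: sum_lessThan_telescope)
  then show ?thesis
    by (simp only: convergent_diff_const_right_iff)
qed

instance l2 :: (euclidean_space) complete_space
proof
  fix X :: "nat \<Rightarrow> 'a l2"
  assume X: "Cauchy X"
  have "\<exists>N. \<forall>m\<ge>N. \<forall>n\<ge>N. dist (X m) (X n) < (1/4) ^ k" for k
    using X unfolding Cauchy_def by (auto dest: spec[of _ "(1/4) ^ k"])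
  then obtain N where N: "\<And>k m n. m \<ge> N k \<Longrightarrow> n \<ge> N k \<Longrightarrow> dist (X m) (X n) < (1/4) ^ k"
    by metis
  define r where "r k = (\<Sum>i\<le>k. N i)" for k
  have rN: "r m \<ge> N k" if "k \<le> m" for k m
    unfolding r_def using that by (intro member_le_sum) auto
  define g where "g k = rep_l2 (X (r k))" for k
  have sq: "square_integrable (g k)" for k
    unfolding g_def by (rule square_integrable_rep_l2)
  have [measurable]: "g k \<in> borel_measurable lborel" for k
    using sq by (rule square_integrable_measurable)
  have d: "(\<integral>\<^sup>+x. ennreal ((cmod (g m x - g n x))\<^sup>2) \<partial>lborel) \<le> ennreal ((1/16) ^ k)"
    if "m \<ge> k" "n \<ge> k" for m n k
  proof -
    have "dist (X (r m)) (X (r n)) < (1/4) ^ k"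
      using that by (intro N rN)
    then have "(dist (X (r m)) (X (r n)))\<^sup>2 \<le> ((1/4) ^ k)\<^sup>2"
      by (intro power_mono) auto
    also have "((1/4) ^ k)\<^sup>2 = (1/16 :: real) ^ k"
      using power_mult_distrib[of "1/4 :: real" "1/4" k] by (simp add: power2_eq_square)
    finally show ?thesis
      unfolding g_def nn_integral_l2_dist by (rule ennreal_leI)
  qed
  have "(\<integral>\<^sup>+x. (\<Sum>k. ennreal (8 ^ k * (cmod (g (Suc k) x - g k x))\<^sup>2)) \<partial>lborel)
      = (\<Sum>k. \<integral>\<^sup>+x. ennreal (8 ^ k * (cmod (g (Suc k) x - g k x))\<^sup>2) \<partial>lborel)"
    by (rule nn_integral_suminf) measurable
  also have "\<dots> \<le> (\<Sum>k. ennreal ((1/2) ^ k))"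
  proof (intro suminf_le summableI)
    fix k :: nat
    have "(\<integral>\<^sup>+x. ennreal (8 ^ k * (cmod (g (Suc k) x - g k x))\<^sup>2) \<partial>lborel)
        = ennreal (8 ^ k) * (\<integral>\<^sup>+x. ennreal ((cmod (g (Suc k) x - g k x))\<^sup>2) \<partial>lborel)"
      by (subst nn_integral_cmult[symmetric]) (auto simp: ennreal_mult)
    also have "\<dots> \<le> ennreal (8 ^ k) * ennreal ((1/16) ^ k)"
      by (intro mult_left_mono d) auto
    also have "\<dots> = ennreal ((1/2) ^ k)"
      using power_mult_distrib[of "8 :: real" "1/16" k] by (subst ennreal_mult[symmetric]) simp_all
    finally show "(\<integral>\<^sup>+x. ennreal (8 ^ k * (cmod (g (Suc k) x - g k x))\<^sup>2) \<partial>lborel)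
        \<le> ennreal ((1/2) ^ k)" .
  qed
  also have "\<dots> = ennreal (\<Sum>k. (1/2) ^ k)"
    by (intro suminf_ennreal2) (auto intro: summable_geometric)
  also have "\<dots> < \<infinity>" by simp
  finally have fin: "(\<integral>\<^sup>+x. (\<Sum>k. ennreal (8 ^ k * (cmod (g (Suc k) x - g k x))\<^sup>2)) \<partial>lborel) \<noteq> \<infinity>"
    by simp
  have "AE x in lborel. (\<Sum>k. ennreal (8 ^ k * (cmod (g (Suc k) x - g k x))\<^sup>2)) \<noteq> \<infinity>"
    by (rule nn_integral_PInf_AE[OF _ fin]) measurable
  then have conv: "AE x in lborel. convergent (\<lambda>k. g k x)"
    by (rule eventually_mono) (rule convergent_if_weighted_suminf_finite)
  define G where "G x = lim (\<lambda>k. g k x)" for x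
  have [measurable]: "G \<in> borel_measurable lborel"
    unfolding G_def by measurable
  have lim: "AE x in lborel. (\<lambda>k. g k x) \<longlonglongrightarrow> G x"
    using conv by (rule eventually_mono) (simp add: G_def convergent_LIMSEQ_iff)
  have Gd: "(\<integral>\<^sup>+x. ennreal ((cmod (G x - g k x))\<^sup>2) \<partial>lborel) \<le> ennreal ((1/16) ^ k)" for k
  proof -
    have "(\<integral>\<^sup>+x. ennreal ((cmod (G x - g k x))\<^sup>2) \<partial>lborel)
        = (\<integral>\<^sup>+x. liminf (\<lambda>m. ennreal ((cmod (g m x - g k x))\<^sup>2)) \<partial>lborel)"
    proof (rule nn_integral_cong_AE)
      show "AE x in lborel. ennreal ((cmod (G x - g k x))\<^sup>2)
          = liminf (\<lambda>m. ennreal ((cmod (g m x - g k x))\<^sup>2))"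
        using lim
      proof eventually_elim
        case (elim x)
        have "(\<lambda>m. ennreal ((cmod (g m x - g k x))\<^sup>2)) \<longlonglongrightarrow> ennreal ((cmod (G x - g k x))\<^sup>2)"
          using elim by (intro tendsto_ennrealI tendsto_intros)
        then show ?case
          by (rule lim_imp_Liminf[OF sequentially_bot, symmetric])
      qed
    qed
    also have "\<dots> \<le> liminf (\<lambda>m. \<integral>\<^sup>+x. ennreal ((cmod (g m x - g k x))\<^sup>2) \<partial>lborel)"
      by (rule nn_integral_liminf) measurable
    also have "\<dots> \<le> liminf (\<lambda>m::nat. ennreal ((1/16) ^ k))"
      by (rule Liminf_mono, rule eventually_sequentiallyI[of k], rule d) simp_all
    also have "\<dots> = ennreal ((1/16) ^ k)"
      by (simp add: Liminf_const)
    finally show ?thesis .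
  qed
  have sqd: "square_integrable (\<lambda>x. G x - g k x)" for k
    unfolding square_integrable_def
  proof (intro conjI integrableI_bounded)
    have "(\<integral>\<^sup>+x. ennreal (norm ((cmod (G x - g k x))\<^sup>2)) \<partial>lborel)
        = (\<integral>\<^sup>+x. ennreal ((cmod (G x - g k x))\<^sup>2) \<partial>lborel)" by simp
    also have "\<dots> < \<infinity>"
      by (rule le_less_trans[OF Gd]) simp
    finally show "(\<integral>\<^sup>+x. ennreal (norm ((cmod (G x - g k x))\<^sup>2)) \<partial>lborel) < \<infinity>" .
  qed measurable
  have sqG: "square_integrable G"
    using square_integrable_add[OF sqd sq, of 0 0] by simp
  have dG: "dist (X (r k)) (abs_l2 G) \<le> (1/4) ^ k" for k
  proof -
    have "abs_l2 G - X (r k) = abs_l2 (\<lambda>x. G x - g k x)"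
      using abs_l2_diff[OF sqG sq, of k] by (simp add: g_def abs_rep_l2)
    then have "ennreal ((dist (X (r k)) (abs_l2 G))\<^sup>2)
        = ennreal (\<integral>x. (cmod (G x - g k x))\<^sup>2 \<partial>lborel)"
      using norm_abs_l2[OF sqd] by (simp add: dist_norm norm_minus_commute)
    also have "\<dots> = (\<integral>\<^sup>+x. ennreal ((cmod (G x - g k x))\<^sup>2) \<partial>lborel)"
      using sqd by (intro nn_integral_eq_integral[symmetric]) (auto simp: square_integrable_def)
    also have "\<dots> \<le> ennreal ((1/16) ^ k)" by (rule Gd)
    finally have "(dist (X (r k)) (abs_l2 G))\<^sup>2 \<le> (1/16) ^ k"
      by (subst (asm) ennreal_le_iff) auto
    also have "(1/16 :: real) ^ k = ((1/4) ^ k)\<^sup>2"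
      using power_mult_distrib[of "1/4 :: real" "1/4" k] by (simp add: power2_eq_square)
    finally show ?thesis
      by (rule power2_le_imp_le) simp
  qed
  have "X \<longlonglongrightarrow> abs_l2 G"
  proof (rule LIMSEQ_I)
    fix e :: real assume "0 < e"
    then have "\<exists>k. (1/4 :: real) ^ k < e / 2"
      by (intro real_arch_pow_inv) auto
    then obtain k where k: "(1/4 :: real) ^ k < e / 2" ..
    have "norm (X n - abs_l2 G) < e" if "n \<ge> N k" for n
    proof -
      have "dist (X n) (abs_l2 G) \<le> dist (X n) (X (r k)) + dist (X (r k)) (abs_l2 G)"
        by (rule dist_triangle)
      also have "\<dots> < (1/4) ^ k + (1/4) ^ k"
        using N[OF that rN[OF order_refl]] dG[of k] by simp
      finally show ?thesis using k by (simp add: dist_norm)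
    qed
    then show "\<exists>n0. \<forall>n\<ge>n0. norm (X n - abs_l2 G) < e" by auto
  qed
  then show "convergent X" by (auto simp: convergent_def)
qed



section \<open>Test functions\<close>

definition pd :: "'d::finite \<Rightarrow> (real ^ 'd \<Rightarrow> complex) \<Rightarrow> real ^ 'd \<Rightarrow> complex" where
  "pd i f x = frechet_derivative f (at x) (axis i 1)"

primrec Ck :: "nat \<Rightarrow> (real ^ 'd::finite \<Rightarrow> complex) \<Rightarrow> bool" where
  "Ck 0 f \<longleftrightarrow> continuous_on UNIV f"
| "Ck (Suc k) f \<longleftrightarrow> (\<forall>x. f differentiable (at x)) \<and> (\<forall>i. Ck k (pd i f))"

definition test_functions :: "(real ^ 'd::finite \<Rightarrow> complex) set" where
  "test_functions = {\<phi>. (\<forall>k. Ck k \<phi>) \<and> compact (closure {x. \<phi> x \<noteq> 0})}"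


section \<open>The spaces $\mathcal{W}$, $\mathcal{W}^*$, $H^1$\<close>

text \<open>
  Elements of $L^2(\mathbb{R}^d;\mathbb{C}^d)$ are vectors of \<^typ>\<open>'a l2\<close>; the library norm on
  vectors is the Euclidean combination of the component norms, hence the usual $L^2$ norm.
  \<^term>\<open>abs_l2\<close> maps a square-integrable function to its class.
\<close>

type_synonym 'd vfield = "((real, 'd) vec l2, 'd) vec"

definition cinner_vec :: "'d::finite vfield \<Rightarrow> 'd vfield \<Rightarrow> complex" where
  "cinner_vec u v = (\<Sum>i\<in>UNIV. cinner_l2 (u $ i) (v $ i))"

definition test_grad :: "(real ^ 'd::finite \<Rightarrow> complex) \<Rightarrow> 'd vfield" where
  "test_grad \<phi> = (\<chi> i. abs_l2 (pd i \<phi>))"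

text \<open>
  By definition of the norm, $\varphi\mapsto\nabla\varphi$ is an isometry from $C_c^\infty$ with
  $\|\cdot\|_{\mathcal W}$ into the Hilbert space $L^2(\mathbb{R}^d;\mathbb{C}^d)$, so the
  completion is the closure of its image: an element $u$ of $\mathcal W$ is represented by
  $\nabla u$, a test function $\varphi$ by \<^term>\<open>test_grad \<phi>\<close>. Thus \<^term>\<open>norm\<close> is the
  norm $\|\nabla u\|_{L^2}$ and \<^term>\<open>cinner_vec\<close> is $\langle\nabla u,\nabla v\rangle_{L^2}$.
  For $d\le2$ these elements have no canonical representative as functions.
\<close>

definition W :: "'d::finite vfield set" where
  "W = closure (test_grad ` test_functions)"

lemma complete_W: "complete W"
  by (simp add: W_def complete_eq_closed)

definition W_dual :: "('d::finite vfield \<Rightarrow> complex) set" where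
  "W_dual = {l \<in> extensional W.
     (\<forall>u\<in>W. \<forall>v\<in>W. l (u + v) = l u + l v) \<and>
     (\<forall>c. \<forall>u\<in>W. l (c *\<^sub>C u) = cnj c * l u) \<and>
     (\<exists>C. \<forall>u\<in>W. cmod (l u) \<le> C * norm u)}"

definition W_dual_norm :: "('d::finite vfield \<Rightarrow> complex) \<Rightarrow> real" where
  "W_dual_norm l = (SUP u\<in>{u \<in> W. norm u \<le> 1}. cmod (l u))"

definition extends_to_W :: "(real ^ 'd::finite) l2 \<Rightarrow> ('d vfield \<Rightarrow> complex) \<Rightarrow> bool" where
  "extends_to_W h l \<longleftrightarrow>
     l \<in> W_dual \<and> (\<forall>\<phi>\<in>test_functions. l (test_grad \<phi>) = cinner_l2 h (abs_l2 \<phi>))"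

text \<open>The extension is unique because test functions are dense in $\mathcal W$.\<close>

definition W_functional :: "(real ^ 'd::finite) l2 \<Rightarrow> 'd vfield \<Rightarrow> complex" where
  "W_functional h = (THE l. extends_to_W h l)"

definition Laplacian :: "'d::finite vfield \<Rightarrow> 'd vfield \<Rightarrow> complex" where
  "Laplacian u = (\<lambda>v\<in>W. - cinner_vec u v)"

definition weak_gradient :: "(real ^ 'd::finite) l2 \<Rightarrow> 'd vfield \<Rightarrow> bool" where
  "weak_gradient f v \<longleftrightarrow>
     (\<forall>\<phi>\<in>test_functions. \<forall>i. cinner_l2 f (abs_l2 (pd i \<phi>)) = - cinner_l2 (v $ i) (abs_l2 \<phi>))"

definition H1 :: "(real ^ 'd::finite) l2 set" where
  "H1 = {f. \<exists>v. weak_gradient f v}"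

text \<open>
  The embedding $H^1\hookrightarrow\mathcal W$. Since elements of $\mathcal W$ are represented by
  their gradients, it maps $f$ to its (unique) weak gradient, which lies in $\mathcal W$ because
  $C_c^\infty$ is dense in $H^1$; it is injective because no nonzero $L^2$ function is constant.
\<close>

definition H1_to_W :: "(real ^ 'd::finite) l2 \<Rightarrow> 'd vfield" where
  "H1_to_W f = (THE v. weak_gradient f v)"


section \<open>The wave operator and its semigroup\<close>

text \<open>The library norm on pairs is $\|(f,g)\|^2=\|f\|^2+\|g\|^2$.\<close>

type_synonym 'd energy = "'d vfield \<times> (real, 'd) vec l2"

definition energy_space :: "'d::finite energy set" where
  "energy_space = W \<times> UNIV"

text \<open>
  $\Delta f-g=h$ for $h\in L^2$ is an equality of antilinear functionals on $C_c^\infty$, on which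
  $L^2$ functions act by the $L^2$ pairing.
\<close>

definition Laplacian_minus_eq ::
  "'d::finite vfield \<Rightarrow> (real ^ 'd) l2 \<Rightarrow> (real ^ 'd) l2 \<Rightarrow> bool" where
  "Laplacian_minus_eq f g h \<longleftrightarrow>
     (\<forall>\<phi>\<in>test_functions.
        Laplacian f (test_grad \<phi>) - cinner_l2 g (abs_l2 \<phi>) = cinner_l2 h (abs_l2 \<phi>))"

text \<open>The graph of $\mathcal A$; its domain is the set of $(f,g)$ for which such an $h$ exists.\<close>

definition wave_operator :: "('d::finite energy \<times> 'd energy) set" where
  "wave_operator =
     {((f, g), (H1_to_W g, h)) | f g h. f \<in> W \<and> g \<in> H1 \<and> Laplacian_minus_eq f g h}"

definition C0_contraction_semigroup ::
  "'h::{real_normed_vector, scaleC} set \<Rightarrow> (real \<Rightarrow> 'h \<Rightarrow> 'h) \<Rightarrow> bool" where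
  "C0_contraction_semigroup X T \<longleftrightarrow>
     (\<forall>t\<ge>0. \<forall>x\<in>X. T t x \<in> X) \<and>
     (\<forall>t\<ge>0. \<forall>x\<in>X. \<forall>y\<in>X. T t (x + y) = T t x + T t y) \<and>
     (\<forall>t\<ge>0. \<forall>c. \<forall>x\<in>X. T t (c *\<^sub>C x) = c *\<^sub>C T t x) \<and>
     (\<forall>t\<ge>0. \<forall>x\<in>X. norm (T t x) \<le> norm x) \<and>
     (\<forall>x\<in>X. T 0 x = x) \<and>
     (\<forall>s\<ge>0. \<forall>t\<ge>0. \<forall>x\<in>X. T (s + t) x = T s (T t x)) \<and>
     (\<forall>x\<in>X. ((\<lambda>t. T t x) \<longlongrightarrow> x) (at_right 0))"

definition generator ::
  "'h::real_normed_vector set \<Rightarrow> (real \<Rightarrow> 'h \<Rightarrow> 'h) \<Rightarrow> ('h \<times> 'h) set" where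
  "generator X T =
     {(x, y). x \<in> X \<and> y \<in> X \<and> ((\<lambda>t. (T t x - x) /\<^sub>R t) \<longlongrightarrow> y) (at_right 0)}"

text \<open>
  \<open>generates X A T\<close>: the operator with graph \<open>A\<close> generates the $C_0$-contraction semigroup
  \<open>T\<close> on \<open>X\<close>, that is, $T(t)=e^{tA}$. On \<open>X\<close> and for $t\ge0$, \<open>T\<close> is determined by \<open>A\<close>.
\<close>

definition generates ::
  "'h::{real_normed_vector, scaleC} set \<Rightarrow> ('h \<times> 'h) set \<Rightarrow> (real \<Rightarrow> 'h \<Rightarrow> 'h) \<Rightarrow> bool" where
  "generates X A T \<longleftrightarrow> C0_contraction_semigroup X T \<and> generator X T = A"


section \<open>Initial data and solutions\<close>

type_synonym 'd data = "(real, 'd) vec l2 \<times> (real, 'd) vec l2"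

definition K_space :: "'d::finite data set" where
  "K_space = {(f, g). f \<in> H1 \<and> (\<exists>l. extends_to_W (f + g) l)}"

definition data_to_energy :: "'d::finite data \<Rightarrow> 'd energy" where
  "data_to_energy = (\<lambda>(f, g). (H1_to_W f, g))"

definition K_norm :: "'d::finite data \<Rightarrow> real" where
  "K_norm = (\<lambda>(f, g). sqrt ((norm (data_to_energy (f, g)))\<^sup>2 + (norm f)\<^sup>2
     + (W_dual_norm (W_functional (f + g)))\<^sup>2))"

text \<open>
  The mild solution and its time derivative: the components of $e^{t\mathcal A}F$, where
  \<open>T\<close> is the semigroup. The first one is an element of $\mathcal W$.
\<close>

definition mild_solution ::
  "(real \<Rightarrow> 'd::finite energy \<Rightarrow> 'd energy) \<Rightarrow> 'd data \<Rightarrow> real \<Rightarrow> 'd vfield" where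
  "mild_solution T F t = fst (T t (data_to_energy F))"

definition mild_solution_dt ::
  "(real \<Rightarrow> 'd::finite energy \<Rightarrow> 'd energy) \<Rightarrow> 'd data \<Rightarrow> real \<Rightarrow> (real ^ 'd) l2" where
  "mild_solution_dt T F t = snd (T t (data_to_energy F))"

text \<open>
  $\|u\|_{L^2}\le c$ for $u\in\mathcal W$: by definition this includes that $u$ is (the image of)
  an $L^2$ function $v$; having its gradient in $L^2$, $v$ is then in $H^1$.
\<close>

definition L2_norm_le :: "'d::finite vfield \<Rightarrow> real \<Rightarrow> bool" where
  "L2_norm_le u c \<longleftrightarrow> (\<exists>v\<in>H1. H1_to_W v = u \<and> norm v \<le> c)"

definition decay_const :: "nat \<Rightarrow> real" where
  "decay_const j = sqrt (SUP s\<in>{0..}. s ^ (j + 1) * exp (- 2 * s))"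

end

theory Submission
  imports Defs "HOL-Computational_Algebra.Polynomial" "HOL-Real_Asymp.Real_Asymp"
begin

text \<open>
  For a frequency $0<\kappa\le 1/2$ let $\mu$ be the root of $\mu^2+\mu+\kappa^2=0$ closest to zero.
  If $f$ were an eigenfunction of the Laplacian for $-\kappa^2$, the solution with data $(f,\mu f)$
  would be $e^{\mu t}f$. Wide wave packets $\psi(x)=c\,e^{i\kappa x_i}\eta(\epsilon x)$ and
  $f=\partial_i\psi$ satisfy $\|\Delta f+\kappa^2f\|\to 0$ as $\epsilon\to 0$ with $\|\psi\|$ fixed, and
  since the semigroup is contractive the error of $e^{\mu t}f$ at a fixed time is at most $t$ times
  this norm. Moreover $|\langle f,\varphi\rangle|=|\langle\psi,\partial_i\varphi\rangle|\le\|\psi\|\|\varphi\|_{\mathcal W}$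
  bounds the $\mathcal W^*$ norm. In the limit this gives lower bounds for the three rates at every
  $t>0$ and every $\kappa$; the choice $\kappa^2=s/t$ with $s=(j+1)/2$, the maximiser of $s^{j+1}e^{-2s}$,
  and $t\to\infty$ yield the constants.
\<close>

section \<open>Smooth functions\<close>

text \<open>The Laplacian on the whole space has no eigenfunctions in L2, and the error of an
  approximate one is multiplied by t. The order of the limits removes this obstacle: t and \<kappa>
  stay fixed while the packets widen, which leaves inequalities without error terms, and only these
  are evaluated along \<kappa>^2 = s/t. At low frequency a single term governs the norm of the data:
  f + \<mu> f = (1 + \<mu>) \<open>pd i \<psi>\<close> has dual norm at most (1 + \<mu>) times the
  norm of \<psi>, while the remaining terms are of order \<kappa>. Relative to \<psi>, the solution,
  its gradient and its time derivative have the sizes \<kappa>, \<kappa>^2 and |\<mu>| \<kappa>,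
  times e^(\<mu> t). As \<mu> is close to -\<kappa>^2, the last factor is close to \<kappa>^3, and
  \<kappa>^2 = s/t turns the three sizes into t^(-(j+1)/2) times the square root of s^(j+1) e^(-2s).
  This is the origin of the function that is maximised. No Fourier transform enters: everything is
  computed on test functions by integration by parts and rescaling.\<close>

lemma pd_eqI: "(f has_derivative D) (at x) \<Longrightarrow> pd i f x = D (axis i 1)"
  by (simp add: pd_def frechet_derivative_at[symmetric])

lemma differentiable_pd:
  "f differentiable (at x) \<Longrightarrow> (f has_derivative frechet_derivative f (at x)) (at x)"
  by (simp add: frechet_derivative_works)

lemma pd_add:
  assumes "f differentiable (at x)" "g differentiable (at x)"
  shows "pd i (\<lambda>x. f x + g x) x = pd i f x + pd i g x"
  by (rule trans[OF pd_eqI[OF has_derivative_add[OF assms[THEN differentiable_pd]]]]) (simp add: pd_def)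

lemma pd_mult:
  assumes "f differentiable (at x)" "g differentiable (at x)"
  shows "pd i (\<lambda>x. f x * g x) x = pd i f x * g x + f x * pd i g x"
  by (rule trans[OF pd_eqI[OF has_derivative_mult[OF assms[THEN differentiable_pd]]]]) (simp add: pd_def)

lemma pd_cmult:
  assumes "f differentiable (at x)"
  shows "pd i (\<lambda>x. c * f x) x = c * pd i f x"
  by (rule trans[OF pd_eqI[OF has_derivative_mult_right[OF assms[THEN differentiable_pd]]]]) (simp add: pd_def)

lemma pd_cnj:
  assumes "f differentiable (at x)"
  shows "pd i (\<lambda>x. cnj (f x)) x = cnj (pd i f x)"
  by (rule trans[OF pd_eqI[OF has_derivative_cnj[OF assms[THEN differentiable_pd]]]]) (simp add: pd_def)

lemma has_derivative_scaled:
  fixes f :: "real ^ 'd::finite \<Rightarrow> complex"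
  assumes "f differentiable (at (r *\<^sub>R x))"
  shows "((\<lambda>x. f (r *\<^sub>R x)) has_derivative (\<lambda>v. frechet_derivative f (at (r *\<^sub>R x)) (r *\<^sub>R v))) (at x)"
proof -
  have "((\<lambda>x::real^'d. r *\<^sub>R x) has_derivative (\<lambda>v. r *\<^sub>R v)) (at x)"
    by (auto intro!: derivative_eq_intros)
  from diff_chain_at[OF this differentiable_pd[OF assms]] show ?thesis
    by (simp add: o_def)
qed

lemma pd_scaled:
  assumes "f differentiable (at (r *\<^sub>R x))"
  shows "pd i (\<lambda>x. f (r *\<^sub>R x)) x = of_real r * pd i f (r *\<^sub>R x)"
proof -
  have "linear (frechet_derivative f (at (r *\<^sub>R x)))"
    using assms by (rule linear_frechet_derivative)
  then show ?thesis
    by (subst pd_eqI[OF has_derivative_scaled[OF assms]])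
      (simp add: linear_scale pd_def scaleR_conv_of_real[where 'a=complex])
qed

definition smooth :: "(real ^ 'd::finite \<Rightarrow> complex) \<Rightarrow> bool" where
  "smooth f \<longleftrightarrow> (\<forall>k. Ck k f)"

lemma smooth_differentiable: "smooth f \<Longrightarrow> f differentiable (at x)"
  unfolding smooth_def by (metis Ck.simps(2))

lemma smooth_pd: "smooth f \<Longrightarrow> smooth (pd i f)"
  unfolding smooth_def by (metis Ck.simps(2))

lemma smooth_continuous: "smooth f \<Longrightarrow> continuous_on S f"
  unfolding smooth_def by (metis Ck.simps(1) continuous_on_subset subset_UNIV)

lemma smooth_measurable: "smooth f \<Longrightarrow> f \<in> borel_measurable borel"
  by (simp add: borel_measurable_continuous_onI smooth_continuous)

lemma differentiable_imp_continuous_on_UNIV: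
  fixes f :: "'a::real_normed_vector \<Rightarrow> 'b::real_normed_vector"
  shows "\<forall>x. f differentiable (at x) \<Longrightarrow> continuous_on UNIV f"
  by (simp add: continuous_at_imp_continuous_on differentiable_imp_continuous_within)

text \<open>Replaces the induction over all orders by two closure checks on an explicit family.
  Continuity at order 0 comes for free from differentiability.\<close>

lemma smooth_coinduct:
  assumes "f \<in> S"
    and S: "\<And>f x. f \<in> S \<Longrightarrow> f differentiable (at x)" "\<And>f i. f \<in> S \<Longrightarrow> pd i f \<in> S"
  shows "smooth f"
proof -
  have "Ck k f" if "f \<in> S" for k f
    using that
  proof (induction k arbitrary: f)
    case 0
    then show ?case using S(1) by (simp add: differentiable_imp_continuous_on_UNIV)
  next
    case (Suc k)
    then show ?case using S by simp
  qed
  then show ?thesis using assms(1) by (simp add: smooth_def)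
qed

lemma smooth_const: "smooth (\<lambda>x. c)"
proof (rule smooth_coinduct[where S = "range (\<lambda>c x. c)"])
  fix f :: "real ^ 'a \<Rightarrow> complex" and i
  assume "f \<in> range (\<lambda>c x. c)"
  then obtain c where f: "f = (\<lambda>x. c)" by blast
  have "pd i f = (\<lambda>x. 0)"
    unfolding f by (rule ext, rule pd_eqI, rule has_derivative_const)
  then show "pd i f \<in> range (\<lambda>c x. c)"
    by simp
qed auto

text \<open>The product rule leaves one factor undifferentiated, so the induction in
  \<open>Ck_mult\<close> has to lower the order of that factor.\<close>

lemma Ck_Suc_imp_Ck: "Ck (Suc k) f \<Longrightarrow> Ck k f"
proof (induction k arbitrary: f)
  case 0
  then show ?case by (simp add: differentiable_imp_continuous_on_UNIV)
next
  case (Suc k)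
  then show ?case by (metis Ck.simps(2))
qed

lemma Ck_add: "Ck k f \<Longrightarrow> Ck k g \<Longrightarrow> Ck k (\<lambda>x. f x + g x)"
proof (induction k arbitrary: f g)
  case 0
  then show ?case by (auto intro: continuous_intros)
next
  case (Suc k)
  have "pd i (\<lambda>x. f x + g x) = (\<lambda>x. pd i f x + pd i g x)" for i
    using Suc.prems by (auto simp: pd_add)
  then show ?case using Suc by auto
qed

lemma Ck_mult: "Ck k f \<Longrightarrow> Ck k g \<Longrightarrow> Ck k (\<lambda>x. f x * g x)"
proof (induction k arbitrary: f g)
  case 0
  then show ?case by (auto intro: continuous_intros)
next
  case (Suc k)
  have "pd i (\<lambda>x. f x * g x) = (\<lambda>x. pd i f x * g x + f x * pd i g x)" for i
    using Suc.prems by (auto simp: pd_mult)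
  then show ?case
    using Suc Suc.prems[THEN Ck_Suc_imp_Ck] by (auto intro!: Ck_add)
qed

lemma Ck_scaled: "Ck k f \<Longrightarrow> Ck k (\<lambda>x. f (r *\<^sub>R x))"
proof (induction k arbitrary: f)
  case 0
  have "continuous_on UNIV (\<lambda>x::real^'a. r *\<^sub>R x)"
    by (intro continuous_intros)
  with 0 show ?case by (auto intro: continuous_on_compose2[of UNIV f])
next
  case (Suc k)
  have "pd i (\<lambda>x. f (r *\<^sub>R x)) = (\<lambda>x. of_real r * pd i f (r *\<^sub>R x))" for i
    using Suc.prems by (auto simp: pd_scaled)
  moreover have "(\<lambda>x. f (r *\<^sub>R x)) differentiable (at x)" for x
    using Suc.prems by (intro differentiableI[OF has_derivative_scaled]) simp
  moreover have "smooth (\<lambda>x::real^'a. of_real r)"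
    by (rule smooth_const)
  then have "Ck k (\<lambda>x. of_real r * pd i f (r *\<^sub>R x))" for i
    using Suc by (intro Ck_mult) (simp_all add: smooth_def)
  ultimately show ?case by simp
qed

lemma smooth_add: "smooth f \<Longrightarrow> smooth g \<Longrightarrow> smooth (\<lambda>x. f x + g x)"
  and smooth_mult: "smooth f \<Longrightarrow> smooth g \<Longrightarrow> smooth (\<lambda>x. f x * g x)"
  and smooth_scaled: "smooth f \<Longrightarrow> smooth (\<lambda>x. f (r *\<^sub>R x))"
  by (auto simp: smooth_def Ck_add Ck_mult Ck_scaled)

lemma smooth_cmult: "smooth f \<Longrightarrow> smooth (\<lambda>x. c * f x)"
  by (intro smooth_mult smooth_const)

lemma smooth_cnj: "smooth f \<Longrightarrow> smooth (\<lambda>x. cnj (f x))"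
proof (rule smooth_coinduct[where S = "(\<lambda>f x. cnj (f x)) ` {f. smooth f}"])
  fix g :: "real ^ 'a \<Rightarrow> complex" and x i
  assume "g \<in> (\<lambda>f x. cnj (f x)) ` {f. smooth f}"
  then obtain f where f: "smooth f" "g = (\<lambda>x. cnj (f x))" by auto
  show "g differentiable (at x)"
    using f has_derivative_cnj[OF differentiable_pd[OF smooth_differentiable[OF f(1), of x]]]
    by (auto simp: differentiable_def)
  have "pd i g = (\<lambda>x. cnj (pd i f x))"
    using f by (auto simp: pd_cnj smooth_differentiable)
  then show "pd i g \<in> (\<lambda>f x. cnj (f x)) ` {f. smooth f}"
    using f smooth_pd by auto
qed auto

lemma smooth_prod: "(\<And>j. j \<in> A \<Longrightarrow> smooth (f j)) \<Longrightarrow> smooth (\<lambda>x. \<Prod>j\<in>A. f j x)"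
  by (induction A rule: infinite_finite_induct) (simp_all add: smooth_const smooth_mult)

section \<open>Smooth functions of a single coordinate\<close>

lemma has_derivative_plane:
  fixes g :: "real \<Rightarrow> complex"
  assumes "(g has_vector_derivative g') (at (x $ i))"
  shows "((\<lambda>x. g (x $ i)) has_derivative (\<lambda>v. (v $ i) *\<^sub>R g')) (at x)"
proof -
  have "((\<lambda>x. x $ i) has_derivative (\<lambda>v. v $ i)) (at x)"
    by (intro bounded_linear_imp_has_derivative bounded_linear_vec_nth)
  from diff_chain_at[OF this assms[unfolded has_vector_derivative_def]] show ?thesis
    by (simp add: o_def)
qed

text \<open>The sequence \<open>h\<close> lists the successive derivatives of \<open>h 0\<close>.
  The multiples \<open>c\<close> in the family absorb the factor \<open>axis j 1 $ i\<close>, which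
  is 0 in the directions on which the function does not depend.\<close>

lemma smooth_plane:
  fixes h :: "nat \<Rightarrow> real \<Rightarrow> complex"
  assumes "\<And>m s. (h m has_vector_derivative h (Suc m) s) (at s)"
  shows "smooth (\<lambda>x. h 0 (x $ i))"
proof (rule smooth_coinduct[where S = "{\<lambda>x. c * h m (x $ i) | c m. True}"])
  show "(\<lambda>x. h 0 (x $ i)) \<in> {\<lambda>x. c * h m (x $ i) | c m. True}"
    by (auto intro!: exI[of _ 1] exI[of _ "0::nat"])
  fix g :: "real ^ 'a \<Rightarrow> complex" and x j
  assume "g \<in> {\<lambda>x. c * h m (x $ i) | c m. True}"
  then obtain c m where g: "g = (\<lambda>x. c * h m (x $ i))" by auto
  have D: "(g has_derivative (\<lambda>v. c * ((v $ i) *\<^sub>R h (Suc m) (x $ i)))) (at x)" for x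
    unfolding g by (intro has_derivative_mult_right has_derivative_plane assms)
  show "g differentiable (at x)" using D by (auto simp: differentiable_def)
  have "pd j g = (\<lambda>x. (c * of_real (axis j 1 $ i)) * h (Suc m) (x $ i))"
    by (auto simp: pd_eqI[OF D] scaleR_conv_of_real)
  then show "pd j g \<in> {\<lambda>x. c * h m (x $ i) | c m. True}" by blast
qed

section \<open>Bump functions\<close>

text \<open>The classical function exp (-1/x), extended by 0, is \<open>flat 1\<close>. The
  polynomial factor makes the class closed under differentiation.\<close>

definition flat :: "real poly \<Rightarrow> real \<Rightarrow> real" where
  "flat p x = (if x > 0 then poly p (1 / x) * exp (- (1 / x)) else 0)"

lemma poly_exp_neg_tendsto_0: "((\<lambda>y. poly p y * exp (- y :: real)) \<longlongrightarrow> 0) at_top"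
proof -
  have "((\<lambda>y. (\<Sum>i\<le>degree p. coeff p i * (y ^ i / exp y))) \<longlongrightarrow> (\<Sum>i\<le>degree p. coeff p i * 0)) at_top"
    by (intro tendsto_intros tendsto_power_div_exp_0)
  then show ?thesis
    by (simp add: poly_altdef sum_distrib_right exp_minus divide_inverse mult.assoc)
qed

lemma flat_tendsto_0: "(flat p \<longlongrightarrow> 0) (at_right 0)"
proof -
  have "((\<lambda>x. poly p (inverse x) * exp (- inverse x)) \<longlongrightarrow> 0) (at_right 0)"
    using filterlim_compose[OF poly_exp_neg_tendsto_0 filterlim_inverse_at_top_right] .
  then show ?thesis
    by (rule Lim_transform_eventually) (auto simp: flat_def inverse_eq_divide eventually_at_filter)
qed

text \<open>With y = 1/x, differentiating p(y) e^(-y) gives y^2 (p - p')(y) e^(-y), which explains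
  the polynomial on the right. The point 0 is the only one that needs a limit.\<close>

lemma flat_has_derivative:
  "(flat p has_real_derivative flat ([:0, 0, 1:] * (p - pderiv p)) x) (at x)"
proof (cases x "0::real" rule: linorder_cases)
  case less
  have "((\<lambda>x. 0) has_real_derivative 0) (at x)" by simp
  then show ?thesis
    by (rule DERIV_cong_ev[THEN iffD1, rotated -1])
      (use less eventually_nhds_in_open[of "{..<0}" x] in \<open>auto simp: flat_def elim: eventually_mono\<close>)
next
  case greater
  have "((\<lambda>x. poly p (1 / x) * exp (- (1 / x))) has_real_derivative
     flat ([:0, 0, 1:] * (p - pderiv p)) x) (at x)"
    using greater
    by (auto intro!: derivative_eq_intros DERIV_chain2[OF poly_DERIV] simp: flat_def field_simps power2_eq_square)
  then show ?thesis
    by (rule DERIV_cong_ev[THEN iffD1, rotated -1])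
      (use greater eventually_nhds_in_open[of "{0<..}" x] in \<open>auto simp: flat_def elim: eventually_mono\<close>)
next
  case equal
  \<comment> \<open>The difference quotient \<open>flat p h / h\<close> at 0 is again of the form
    \<open>flat\<close>: the factor 1/h only raises the degree of the polynomial.\<close>
  have "(flat (pCons 0 p) \<longlongrightarrow> 0) (at 0)"
  proof (rule filterlim_split_at)
    show "(flat (pCons 0 p) \<longlongrightarrow> 0) (at_left 0)"
      by (rule Lim_transform_eventually[OF tendsto_const]) (auto simp: eventually_at_filter flat_def)
  qed (rule flat_tendsto_0)
  then have "((\<lambda>h. flat p h / h) \<longlongrightarrow> 0) (at 0)"
    by (rule Lim_transform_eventually) (auto simp: eventually_at_filter flat_def field_simps)
  then show ?thesis
    by (simp add: DERIV_def equal flat_def)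
qed

lemma smooth_flat: "smooth (\<lambda>x. of_real (flat p (c * x $ i + d)))"
proof -
  \<comment> \<open>Each differentiation applies the map of \<open>flat_has_derivative\<close> to
    the polynomial and contributes one factor \<open>c\<close>.\<close>
  define P where "P m = ((\<lambda>p. [:0, 0, 1:] * (p - pderiv p)) ^^ m) p" for m
  define h where "h m s = complex_of_real (c ^ m * flat (P m) (c * s + d))" for m s
  have "(h m has_vector_derivative h (Suc m) s) (at s)" for m s
  proof -
    have "((\<lambda>s. flat (P m) (c * s + d)) has_real_derivative c * flat (P (Suc m)) (c * s + d)) (at s)"
    proof -
      have "((\<lambda>s. c * s + d) has_real_derivative c) (at s)"
        by (auto intro!: derivative_eq_intros)
      from DERIV_chain2[OF flat_has_derivative this] show ?thesis
        by (simp add: P_def mult.commute)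
    qed
    from DERIV_cmult[OF this, of "c ^ m"]
    have "((\<lambda>s. c ^ m * flat (P m) (c * s + d)) has_vector_derivative c ^ Suc m * flat (P (Suc m)) (c * s + d)) (at s)"
      by (simp add: has_real_derivative_iff_has_vector_derivative mult_ac)
    from bounded_linear.has_vector_derivative[OF bounded_linear_of_real this] show ?thesis
      unfolding h_def .
  qed
  from smooth_plane[of h, OF this] show ?thesis
    by (simp add: h_def P_def)
qed

lemma has_vector_derivative_cis:
  "((\<lambda>s. cis (\<kappa> * s)) has_vector_derivative of_real \<kappa> * \<i> * cis (\<kappa> * s)) (at s)"
proof -
  have "((\<lambda>z. exp (\<i> * (of_real \<kappa> * z))) has_field_derivative
      of_real \<kappa> * \<i> * exp (\<i> * of_real (\<kappa> * s))) (at (complex_of_real s))"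
    by (auto intro!: derivative_eq_intros)
  from has_vector_derivative_real_field[OF this] show ?thesis by (simp add: cis_conv_exp)
qed

lemma smooth_cis: "smooth (\<lambda>x. cis (\<kappa> * x $ i))"
proof -
  define h where "h m s = (of_real \<kappa> * \<i>) ^ m * cis (\<kappa> * s)" for m s
  have "(h m has_vector_derivative h (Suc m) s) (at s)" for m s
    using has_vector_derivative_mult_right[OF has_vector_derivative_cis, of "(of_real \<kappa> * \<i>) ^ m" \<kappa> s]
    by (simp add: h_def[abs_def] mult_ac)
  from smooth_plane[of h, OF this] show ?thesis
    by (simp add: h_def)
qed

text \<open>Inside the box each factor is exp (-1/(m s)) with s > 0 and tends to 1 as m grows;
  outside the open box some factor is 0. The indicator of a box is thus a pointwise limit of test
  functions bounded by 1, without any mollification.\<close>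

definition box_bump :: "real \<Rightarrow> real ^ 'd::finite \<Rightarrow> real ^ 'd \<Rightarrow> real ^ 'd \<Rightarrow> complex" where
  "box_bump m a b x = (\<Prod>i\<in>UNIV. of_real (flat 1 (m * (x $ i - a $ i))) * of_real (flat 1 (m * (b $ i - x $ i))))"

lemma test_functionsI:
  assumes "smooth \<phi>" "bounded {x. \<phi> x \<noteq> 0}"
  shows "\<phi> \<in> test_functions"
  using assms by (auto simp: test_functions_def smooth_def compact_eq_bounded_closed)

lemma test_functionsD:
  assumes "\<phi> \<in> test_functions"
  shows "smooth \<phi>" "bounded {x. \<phi> x \<noteq> 0}"
  using assms bounded_subset[OF compact_imp_bounded closure_subset]
  by (auto simp: test_functions_def smooth_def)

lemma box_bump_eq_0: "m > 0 \<Longrightarrow> x \<notin> box a b \<Longrightarrow> box_bump m a b x = 0"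
  by (auto simp: box_bump_def mem_box_cart flat_def zero_less_mult_iff)

lemma norm_flat_1: "\<bar>flat 1 x\<bar> \<le> 1"
  by (simp add: flat_def)

lemma box_bump_test: "m > 0 \<Longrightarrow> box_bump m a b \<in> test_functions"
proof (rule test_functionsI)
  have "smooth (\<lambda>x. complex_of_real (flat 1 (m * (x $ i - a $ i))))"
    "smooth (\<lambda>x. complex_of_real (flat 1 (m * (b $ i - x $ i))))" for i
    using smooth_flat[of 1 m i "- m * a $ i"] smooth_flat[of 1 "-m" i "m * b $ i"]
    by (simp_all add: algebra_simps)
  then show "smooth (box_bump m a b)"
    unfolding box_bump_def by (intro smooth_prod smooth_mult) auto
  assume "m > 0"
  then show "bounded {x. box_bump m a b x \<noteq> 0}"
    by (intro bounded_subset[OF bounded_box[of a b]]) (auto intro: ccontr simp: box_bump_eq_0)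
qed

lemma norm_box_bump: "m > 0 \<Longrightarrow> cmod (box_bump m a b x) \<le> indicator (box a b) x"
proof (cases "x \<in> box a b")
  case True
  have "cmod (box_bump m a b x) \<le> 1"
    unfolding box_bump_def prod_norm[symmetric]
    by (intro prod_le_1) (auto simp: norm_mult intro!: mult_le_one norm_flat_1)
  then show ?thesis using True by simp
qed (simp add: box_bump_eq_0)

lemma box_bump_tendsto:
  "(\<lambda>n. box_bump (real (Suc n)) a b x) \<longlonglongrightarrow> indicator (box a b) x"
proof (cases "x \<in> box a b")
  case False
  then show ?thesis by (simp add: box_bump_eq_0)
next
  case True
  have *: "(\<lambda>n. complex_of_real (flat 1 (real (Suc n) * s))) \<longlonglongrightarrow> of_real 1" if "s > 0" for s
  proof (rule tendsto_of_real)
    have "(\<lambda>n. exp (- (inverse (real (Suc n)) * inverse s))) \<longlonglongrightarrow> exp (- (0 * inverse s))"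
      by (intro tendsto_intros LIMSEQ_inverse_real_of_nat)
    then show "(\<lambda>n. flat 1 (real (Suc n) * s)) \<longlonglongrightarrow> 1"
      using that by (simp add: flat_def inverse_eq_divide zero_less_mult_iff del: of_nat_Suc)
  qed
  have "(\<lambda>n. box_bump (real (Suc n)) a b x) \<longlonglongrightarrow> (\<Prod>i\<in>(UNIV::'a set). of_real 1 * of_real 1)"
    unfolding box_bump_def using True by (intro tendsto_prod tendsto_mult *) (auto simp: mem_box_cart)
  then show ?thesis using True by simp
qed

section \<open>Calculus of the classes in $L^2$\<close>

lemma l2rel_refl: "square_integrable f \<Longrightarrow> l2rel f f"
  by (simp add: l2rel_def)

lemma abs_l2_add:
  "square_integrable f \<Longrightarrow> square_integrable g \<Longrightarrow> abs_l2 (\<lambda>x. f x + g x) = abs_l2 f + abs_l2 g"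
  by (simp add: plus_l2.abs_eq l2rel_refl)

lemma abs_l2_cmult: "square_integrable f \<Longrightarrow> abs_l2 (\<lambda>x. c * f x) = c *\<^sub>C abs_l2 f"
  by (simp add: scaleC_l2.abs_eq l2rel_refl)

lemma cinner_abs_l2:
  "square_integrable f \<Longrightarrow> square_integrable g \<Longrightarrow>
    cinner_l2 (abs_l2 f) (abs_l2 g) = (\<integral>x. f x * cnj (g x) \<partial>lborel)"
  by (simp add: cinner_l2.abs_eq l2rel_refl)

lemma cinner_l2_add_right: "cinner_l2 f (g + h) = cinner_l2 f g + cinner_l2 f h"
  by (subst (1 2 3) cinner_l2_commute) (simp add: cinner_l2_add_left)

lemma cinner_l2_scaleC_right: "cinner_l2 f (c *\<^sub>C g) = cnj c * cinner_l2 f g"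
  by (subst (1 2) cinner_l2_commute) (simp add: cinner_l2_scaleC_left)

lemma minus_l2_eq_scaleC: "- f = (-1) *\<^sub>C (f :: 'a::euclidean_space l2)"
  using scaleR_l2_eq_scaleC[of "-1" f] by simp

lemma cinner_l2_minus_left: "cinner_l2 (- f) g = - cinner_l2 f g"
  by (simp add: minus_l2_eq_scaleC cinner_l2_scaleC_left)

lemma cinner_l2_diff_left: "cinner_l2 (f - g) h = cinner_l2 f h - cinner_l2 g h"
  using cinner_l2_add_left[of f "- g" h] by (simp add: cinner_l2_minus_left)

lemma cinner_l2_0_left: "cinner_l2 0 g = 0"
  using cinner_l2_add_left[of 0 0 g] by simp

lemma cinner_l2_self_norm: "cinner_l2 f f = of_real ((norm f)\<^sup>2)"
  by (simp add: power2_norm_eq_inner inner_l2_def cinner_l2_self)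

lemma norm_scaleC_l2: "norm (c *\<^sub>C f) = cmod c * norm (f :: 'a::euclidean_space l2)"
proof -
  have "complex_of_real ((norm (c *\<^sub>C f))\<^sup>2) = of_real ((cmod c * norm f)\<^sup>2)"
    by (simp add: cinner_l2_self_norm[symmetric] cinner_l2_scaleC_left cinner_l2_scaleC_right
        power_mult_distrib complex_norm_square del: of_real_power)
  then show ?thesis
    by (metis norm_ge_zero mult_nonneg_nonneg of_real_eq_iff power2_eq_iff_nonneg)
qed

lemma cmod_cinner_l2_le: "cmod (cinner_l2 f g) \<le> norm f * norm g"
proof (cases "cinner_l2 f g = 0")
  case False
  \<comment> \<open>Multiplying by the phase \<open>c\<close> makes the complex inner product real
    and nonnegative, so that it coincides with the real inner product, for which Cauchy-Schwarz is
    known.\<close>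
  define c where "c = cnj (sgn (cinner_l2 f g))"
  have "complex_of_real (cmod (cinner_l2 f g)) = cinner_l2 (c *\<^sub>C f) g"
    using False by (simp add: c_def cinner_l2_scaleC_left sgn_eq complex_norm_square[symmetric]
        power2_eq_square mult.commute)
  then have "cmod (cinner_l2 f g) = (c *\<^sub>C f) \<bullet> g"
    by (metis Re_complex_of_real inner_l2_def)
  also have "\<dots> \<le> norm (c *\<^sub>C f) * norm g"
    by (rule norm_cauchy_schwarz)
  also have "\<dots> = norm f * norm g"
    using False by (simp add: norm_scaleC_l2 c_def norm_sgn)
  finally show ?thesis .
qed simp

section \<open>Test functions\<close>

lemma test_functions_0: "\<phi> \<in> test_functions \<Longrightarrow> x \<notin> closure {x. \<phi> x \<noteq> 0} \<Longrightarrow> \<phi> x = 0"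
  using subsetD[OF closure_subset[of "{x. \<phi> x \<noteq> 0}"], of x] by blast

lemma test_functions_pd:
  fixes \<phi> :: "real ^ 'd::finite \<Rightarrow> complex"
  assumes "\<phi> \<in> test_functions"
  shows "pd i \<phi> \<in> test_functions"
proof (rule test_functionsI)
  let ?K = "closure {x. \<phi> x \<noteq> 0}"
  have *: "pd i \<phi> x = 0" if "x \<notin> ?K" for x
  proof -
    have "(\<phi> has_derivative (\<lambda>_. 0)) (at x)"
    proof (rule has_derivative_transform_within_open)
      show "((\<lambda>_. 0) has_derivative (\<lambda>_. 0)) (at x)" by simp
      show "open (- ?K)" "x \<in> - ?K" using that by auto
      show "\<And>y. y \<in> - ?K \<Longrightarrow> 0 = \<phi> y"
        by (rule test_functions_0[OF assms, symmetric]) simp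
    qed
    from pd_eqI[OF this] show ?thesis .
  qed
  show "bounded {x. pd i \<phi> x \<noteq> 0}"
  proof (rule bounded_subset)
    show "bounded ?K" by (intro bounded_closure test_functionsD(2) assms)
    show "{x. pd i \<phi> x \<noteq> 0} \<subseteq> ?K" using * by blast
  qed
qed (intro smooth_pd test_functionsD(1)[OF assms])

lemma test_functions_mult_smooth:
  assumes "\<phi> \<in> test_functions" "smooth f"
  shows "(\<lambda>x. f x * \<phi> x) \<in> test_functions"
  using test_functionsD[OF assms(1)] assms(2)
  by (intro test_functionsI smooth_mult) (auto elim: bounded_subset)

lemma test_functions_cmult: "\<phi> \<in> test_functions \<Longrightarrow> (\<lambda>x. c * \<phi> x) \<in> test_functions"
  by (rule test_functions_mult_smooth[OF _ smooth_const])

lemma test_functions_cnj: "\<phi> \<in> test_functions \<Longrightarrow> (\<lambda>x. cnj (\<phi> x)) \<in> test_functions"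
  using test_functionsD[of \<phi>] by (intro test_functionsI smooth_cnj) auto

lemma test_functions_add:
  assumes "\<phi> \<in> test_functions" "\<psi> \<in> test_functions"
  shows "(\<lambda>x. \<phi> x + \<psi> x) \<in> test_functions"
proof (rule test_functionsI)
  have "{x. \<phi> x + \<psi> x \<noteq> 0} \<subseteq> {x. \<phi> x \<noteq> 0} \<union> {x. \<psi> x \<noteq> 0}" by auto
  then show "bounded {x. \<phi> x + \<psi> x \<noteq> 0}"
    using assms[THEN test_functionsD(2)] by (meson bounded_Un bounded_subset)
qed (intro smooth_add assms[THEN test_functionsD(1)])

lemma test_functions_scaled:
  assumes "\<phi> \<in> test_functions" "r \<noteq> 0"
  shows "(\<lambda>x. \<phi> (r *\<^sub>R x)) \<in> test_functions"
proof (rule test_functionsI)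
  have "{x. \<phi> (r *\<^sub>R x) \<noteq> 0} \<subseteq> (\<lambda>x. inverse r *\<^sub>R x) ` {x. \<phi> x \<noteq> 0}"
    using assms(2) by (auto intro: image_eqI[where x = "r *\<^sub>R x" for x])
  with bounded_scaling[OF test_functionsD(2)[OF assms(1)]]
  show "bounded {x. \<phi> (r *\<^sub>R x) \<noteq> 0}"
    by (rule bounded_subset)
qed (intro smooth_scaled test_functionsD[OF assms(1)])

lemma test_functions_integrable:
  assumes "\<phi> \<in> test_functions"
  shows "integrable lborel \<phi>"
proof -
  let ?K = "closure {x. \<phi> x \<noteq> 0}"
  have "compact ?K"
    using test_functionsD[OF assms] by simp
  then have "integrable lborel (\<lambda>x. indicator ?K x *\<^sub>R \<phi> x)"
    using smooth_continuous[OF test_functionsD(1)[OF assms]] by (rule borel_integrable_compact)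
  also have "(\<lambda>x. indicator ?K x *\<^sub>R \<phi> x) = \<phi>"
  proof
    show "indicator ?K x *\<^sub>R \<phi> x = \<phi> x" for x
      by (cases "x \<in> ?K") (simp, metis test_functions_0[OF assms] scaleR_zero_right)
  qed
  finally show ?thesis .
qed

lemma test_functions_square_integrable:
  assumes "\<phi> \<in> test_functions"
  shows "square_integrable \<phi>"
proof -
  have "(\<lambda>x. \<phi> x * cnj (\<phi> x)) \<in> test_functions"
    by (intro test_functions_mult_smooth test_functions_cnj test_functionsD(1) assms)
  from integrable_norm[OF test_functions_integrable[OF this]]
  show ?thesis
    using smooth_measurable[OF test_functionsD(1)[OF assms]]
    by (simp add: square_integrable_def norm_mult power2_eq_square)
qed

lemma test_functions_bounded:
  assumes "\<phi> \<in> test_functions"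
  shows "\<exists>B\<ge>0. \<forall>x. cmod (\<phi> x) \<le> B"
proof -
  let ?K = "closure {x. \<phi> x \<noteq> 0}"
  have "compact (\<phi> ` ?K)"
    using test_functionsD[OF assms] by (intro compact_continuous_image smooth_continuous) auto
  then obtain B where B: "B > 0" "\<forall>z \<in> \<phi> ` ?K. cmod z \<le> B"
    using bounded_pos[THEN iffD1, OF compact_imp_bounded] by blast
  then have "cmod (\<phi> x) \<le> B" for x
  proof (cases "x \<in> ?K")
    case True
    with B(2) show ?thesis by blast
  next
    case False
    with B(1) show ?thesis by (simp only: test_functions_0[OF assms False] norm_zero less_imp_le)
  qed
  then show ?thesis using B(1) by (intro exI[of _ B]) auto
qed

section \<open>Integration by parts for test functions\<close>

lemma integral_translation:
  fixes f :: "'a::euclidean_space \<Rightarrow> complex"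
  assumes "f \<in> borel_measurable borel"
  shows "(\<integral>x. f (x + c) \<partial>lborel) = (\<integral>x. f x \<partial>lborel)"
proof -
  have "(\<integral>x. f x \<partial>lborel) = (\<integral>x. f x \<partial>(distr lborel borel ((+) c)))"
    by (simp add: lborel_distr_plus)
  also have "\<dots> = (\<integral>x. f (c + x) \<partial>lborel)"
    using assms by (intro integral_distr) simp_all
  finally show ?thesis by (simp add: add.commute)
qed

lemma smooth_directional_derivative:
  assumes "smooth h"
  shows "((\<lambda>s. h (x + s *\<^sub>R axis i 1)) has_vector_derivative pd i h (x + s *\<^sub>R axis i 1)) (at s)"
proof -
  let ?y = "x + s *\<^sub>R axis i (1::real)"
  have "((\<lambda>s. x + s *\<^sub>R axis i (1::real)) has_derivative (\<lambda>v. v *\<^sub>R axis i 1)) (at s)"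
    by (auto intro!: derivative_eq_intros)
  from diff_chain_at[OF this differentiable_pd[OF smooth_differentiable[OF assms, of ?y]]]
  have "((\<lambda>s. h (x + s *\<^sub>R axis i 1)) has_derivative
    (\<lambda>v. frechet_derivative h (at ?y) (v *\<^sub>R axis i 1))) (at s)"
    by (simp add: o_def)
  moreover have "linear (frechet_derivative h (at ?y))"
    by (intro linear_frechet_derivative smooth_differentiable assms)
  ultimately show ?thesis
    by (simp add: has_vector_derivative_def pd_def linear_scale)
qed

text \<open>
  By translation invariance the difference quotients have integral zero; they converge boundedly to
  the derivative.
\<close>

lemma integral_pd_eq_0:
  fixes h :: "real ^ 'd::finite \<Rightarrow> complex"
  assumes h: "h \<in> test_functions"
  shows "(\<integral>x. pd i h x \<partial>lborel) = 0"
proof -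
  let ?e = "axis i 1 :: real ^ 'd"
  define D where "D n x = real (Suc n) *\<^sub>R (h (x + (1 / real (Suc n)) *\<^sub>R ?e) - h x)" for n x
  have sm: "smooth h" by (rule test_functionsD[OF h])
  have [measurable]: "h \<in> borel_measurable borel" "pd i h \<in> borel_measurable borel"
    using sm by (auto intro!: smooth_measurable smooth_pd)
  obtain B where B: "B \<ge> 0" "\<And>x. cmod (pd i h x) \<le> B"
    using test_functions_bounded[OF test_functions_pd[OF h]] by blast
  obtain R where R: "\<And>x. h x \<noteq> 0 \<Longrightarrow> norm x \<le> R"
    using test_functionsD(2)[OF h] by (auto simp: bounded_iff)
  have int_shift: "integrable lborel (\<lambda>x. h (x + c))" for c
  proof -
    have "integrable (distr lborel borel ((+) c)) h"
      using test_functions_integrable[OF h] by (simp add: lborel_distr_plus)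
    then show ?thesis
      by (subst (asm) integrable_distr_eq) (auto simp: add.commute)
  qed
  have int0: "(\<integral>x. D n x \<partial>lborel) = 0" for n
    using int_shift test_functions_integrable[OF h] by (simp add: D_def integral_translation)
  \<comment> \<open>The shift 1/(n+1) is at most 1, so all difference quotients vanish outside the
    ball of radius \<open>R + 1\<close>; inside it the mean value inequality gives the bound
    \<open>B\<close>.\<close>
  have bound: "cmod (D n x) \<le> B * indicator (cball 0 (R + 1)) x" for n x
  proof (cases "x \<in> cball 0 (R + 1)")
    case True
    have "norm (h (x + (1 / real (Suc n)) *\<^sub>R ?e) - h (x + 0 *\<^sub>R ?e)) \<le> B * norm (1 / real (Suc n) - 0)"
    proof (rule differentiable_bound[of UNIV])
      show "((\<lambda>s. h (x + s *\<^sub>R ?e)) has_derivative (\<lambda>v. v *\<^sub>R pd i h (x + s *\<^sub>R ?e))) (at s within UNIV)" for s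
        using smooth_directional_derivative[OF sm] by (simp add: has_vector_derivative_def)
      show "onorm (\<lambda>v. v *\<^sub>R pd i h (x + s *\<^sub>R ?e)) \<le> B" for s
        using B by (intro onorm_le) (simp add: mult.commute[of B] mult_left_mono)
    qed auto
    then show ?thesis
      using True by (simp add: D_def pos_divide_le_eq pos_le_divide_eq mult.commute del: of_nat_Suc)
  next
    case False
    have "norm x \<le> norm (x + (1 / real (Suc n)) *\<^sub>R ?e) + norm ((1 / real (Suc n)) *\<^sub>R ?e)"
      using norm_triangle_ineq4[of "x + (1 / real (Suc n)) *\<^sub>R ?e" "(1 / real (Suc n)) *\<^sub>R ?e"] by simp
    also have "norm ((1 / real (Suc n)) *\<^sub>R ?e) \<le> 1"
      by simp
    finally have "h x = 0" "h (x + (1 / real (Suc n)) *\<^sub>R ?e) = 0"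
      using False R[of x] R[of "x + (1 / real (Suc n)) *\<^sub>R ?e"] by fastforce+
    then show ?thesis using False by (simp add: D_def)
  qed
  have lim: "(\<lambda>n. D n x) \<longlonglongrightarrow> pd i h x" for x
  proof -
    have "((\<lambda>s. (h (x + s *\<^sub>R ?e) - h x - s *\<^sub>R pd i h x) /\<^sub>R \<bar>s\<bar>) \<longlongrightarrow> 0) (at 0)"
      using smooth_directional_derivative[OF sm, of x i 0]
      by (simp add: has_vector_derivative_def has_derivative_at_within)
    then have "((\<lambda>s. norm ((h (x + s *\<^sub>R ?e) - h x - s *\<^sub>R pd i h x) /\<^sub>R \<bar>s\<bar>)) \<longlongrightarrow> 0) (at 0)"
      by (rule tendsto_norm_zero)
    then have "((\<lambda>s. norm ((h (x + s *\<^sub>R ?e) - h x) /\<^sub>R s - pd i h x)) \<longlongrightarrow> 0) (at 0)"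
    proof (rule Lim_transform_eventually)
      have "norm ((h (x + s *\<^sub>R ?e) - h x - s *\<^sub>R pd i h x) /\<^sub>R \<bar>s\<bar>)
          = norm ((h (x + s *\<^sub>R ?e) - h x) /\<^sub>R s - pd i h x)" if "s \<noteq> 0" for s
      proof -
        have "(h (x + s *\<^sub>R ?e) - h x) /\<^sub>R s - pd i h x
          = (h (x + s *\<^sub>R ?e) - h x - s *\<^sub>R pd i h x) /\<^sub>R s"
          using that by (simp add: scaleR_diff_right)
        then show ?thesis by simp
      qed
      then show "\<forall>\<^sub>F s in at 0. norm ((h (x + s *\<^sub>R ?e) - h x - s *\<^sub>R pd i h x) /\<^sub>R \<bar>s\<bar>)
          = norm ((h (x + s *\<^sub>R ?e) - h x) /\<^sub>R s - pd i h x)"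
        by (simp add: eventually_at_filter)
    qed
    then have "((\<lambda>s. (h (x + s *\<^sub>R ?e) - h x) /\<^sub>R s) \<longlongrightarrow> pd i h x) (at 0)"
      by (rule LIM_zero_cancel[OF tendsto_norm_zero_cancel])
    moreover have "filterlim (\<lambda>n. 1 / real (Suc n)) (at 0) sequentially"
      using LIMSEQ_inverse_real_of_nat by (simp add: filterlim_at inverse_eq_divide)
    ultimately have "(\<lambda>n. (h (x + (1 / real (Suc n)) *\<^sub>R ?e) - h x) /\<^sub>R (1 / real (Suc n))) \<longlonglongrightarrow> pd i h x"
      by (rule filterlim_compose)
    then show ?thesis by (simp add: D_def del: of_nat_Suc)
  qed
  have "(\<lambda>n. \<integral>x. D n x \<partial>lborel) \<longlonglongrightarrow> (\<integral>x. pd i h x \<partial>lborel)"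
  proof (rule integral_dominated_convergence)
    show "integrable lborel (\<lambda>x. B * indicator (cball 0 (R + 1)) x)"
      by (intro integrable_mult_right integrable_real_indicator emeasure_bounded_finite) auto
    show "D n \<in> borel_measurable lborel" for n
      unfolding D_def by measurable
  qed (use lim bound in auto)
  then show ?thesis
    unfolding int0 using LIMSEQ_unique[OF tendsto_const] by metis
qed

lemma integral_by_parts:
  assumes "f \<in> test_functions" "g \<in> test_functions"
  shows "cinner_l2 (abs_l2 (pd i f)) (abs_l2 g) = - cinner_l2 (abs_l2 f) (abs_l2 (pd i g))"
proof -
  note test = assms test_functions_pd[OF assms(1)] test_functions_pd[OF assms(2)]
  note si = test[THEN test_functions_square_integrable]
  have "pd i (\<lambda>x. f x * cnj (g x)) = (\<lambda>x. pd i f x * cnj (g x) + f x * cnj (pd i g x))"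
    using assms[THEN test_functionsD(1)]
    by (auto simp: pd_mult pd_cnj smooth_differentiable smooth_cnj)
  moreover have "(\<lambda>x. f x * cnj (g x)) \<in> test_functions"
    by (intro test_functions_mult_smooth test_functions_cnj test_functionsD(1) assms)
  ultimately have "(\<integral>x. pd i f x * cnj (g x) + f x * cnj (pd i g x) \<partial>lborel) = 0"
    using integral_pd_eq_0[of "\<lambda>x. f x * cnj (g x)" i] by simp
  then have "(\<integral>x. pd i f x * cnj (g x) \<partial>lborel) + (\<integral>x. f x * cnj (pd i g x) \<partial>lborel) = 0"
    by (subst (asm) Bochner_Integration.integral_add) (auto intro!: square_integrable_mult_cnj si)
  then show ?thesis
    by (simp add: cinner_abs_l2 si eq_neg_iff_add_eq_0)
qed

section \<open>Density of test functions in $L^2$\<close>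

text \<open>The positive and the negative part of \<open>r\<close> are densities of two measures
  that agree, with finite values, on boxes. Boxes are stable under intersection and generate the
  Borel sets, so the measures and hence the densities agree; the two parts of a real number are
  equal only if it is 0.\<close>

lemma AE_eq_0_if_box_integrals_eq_0:
  fixes r :: "'a::euclidean_space \<Rightarrow> real"
  assumes [measurable]: "r \<in> borel_measurable borel"
    and int: "\<And>a b. integrable lborel (\<lambda>x. indicator (box a b) x * r x)"
    and zero: "\<And>a b. (\<integral>x. indicator (box a b) x * r x \<partial>lborel) = 0"
  shows "AE x in lborel. r x = 0"
proof -
  \<comment> \<open>\<open>ennreal\<close> sends negative numbers to 0, so these densities are the
    positive and the negative part of \<open>r\<close>.\<close>
  let ?M = "density lborel (\<lambda>x. ennreal (r x))" and ?N = "density lborel (\<lambda>x. ennreal (- r x))"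
  let ?E = "range (\<lambda>(a, b). box a b :: 'a set)"
  let ?A = "\<lambda>n::nat. box (- (real n *\<^sub>R One)) (real n *\<^sub>R One) :: 'a set"
  have M: "emeasure ?M (box a b) = (\<integral>\<^sup>+x. ennreal (indicator (box a b) x * r x) \<partial>lborel)" for a b
    by (simp add: emeasure_density) (auto intro!: nn_integral_cong simp: indicator_def)
  have N: "emeasure ?N (box a b) = (\<integral>\<^sup>+x. ennreal (- (indicator (box a b) x * r x)) \<partial>lborel)" for a b
    by (simp add: emeasure_density) (auto intro!: nn_integral_cong simp: indicator_def)
  have fin: "emeasure ?M (box a b) \<noteq> \<infinity>" "emeasure ?N (box a b) \<noteq> \<infinity>" for a b
    using int[of a b] unfolding M N real_integrable_def by auto
  have eq: "emeasure ?M (box a b) = emeasure ?N (box a b)" for a b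
  proof -
    have "enn2real (emeasure ?M (box a b)) = enn2real (emeasure ?N (box a b))"
      using zero[of a b] int[of a b] unfolding M N by (simp add: real_lebesgue_integral_def)
    then show ?thesis
      using fin[of a b] by (metis ennreal_enn2real_if infinity_ennreal_def)
  qed
  have "?M = ?N"
  proof (rule measure_eqI_generator_eq)
    show "Int_stable ?E" by (auto simp: Int_stable_def box_Int_box)
    show "?E \<subseteq> Pow UNIV" "sets ?M = sigma_sets UNIV ?E" "sets ?N = sigma_sets UNIV ?E"
      by (simp_all add: borel_eq_box)
    show "range ?A \<subseteq> ?E" "(\<Union>i. ?A i) = UNIV"
      unfolding UN_box_eq_UNIV by auto
    show "emeasure ?M (?A i) \<noteq> \<infinity>" for i by (rule fin)
  qed (use eq in auto)
  then have "AE x in lborel. ennreal (r x) = ennreal (- r x)"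
    by (intro sigma_finite_measure.density_unique[OF sigma_finite_lborel]) auto
  then show ?thesis
  proof eventually_elim
    case (elim x)
    then show ?case
      by (cases "r x \<ge> 0") (simp_all add: ennreal_neg ennreal_eq_0_iff)
  qed
qed

text \<open>Orthogonality passes from the bumps to the indicator of the box by dominated
  convergence. The majorant is |g| on the box, integrable because the indicator of a bounded box
  lies in L2.\<close>

lemma box_integral_eq_0_if_orthogonal:
  fixes g :: "real ^ 'd::finite \<Rightarrow> complex"
  assumes g: "square_integrable g"
    and orth: "\<And>\<phi>. \<phi> \<in> test_functions \<Longrightarrow> (\<integral>x. g x * cnj (\<phi> x) \<partial>lborel) = 0"
  shows "integrable lborel (\<lambda>x. g x * of_real (indicator (box a b) x))"
    and "(\<integral>x. g x * of_real (indicator (box a b) x) \<partial>lborel) = 0"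
proof -
  let ?I = "\<lambda>x. of_real (indicator (box a b) x) :: complex"
  let ?s = "\<lambda>n x. g x * cnj (box_bump (real (Suc n)) a b x)"
  have [measurable]: "g \<in> borel_measurable borel"
    using g by (simp add: square_integrable_def)
  have "square_integrable ?I"
    unfolding square_integrable_def
  proof
    have "integrable lborel (indicator (box a b) :: real ^ 'd \<Rightarrow> real)"
      by (intro integrable_real_indicator emeasure_bounded_finite) auto
    also have "indicator (box a b) = (\<lambda>x. (cmod (?I x))\<^sup>2)"
      by (auto simp: indicator_def)
    finally show "integrable lborel (\<lambda>x. (cmod (?I x))\<^sup>2)" .
  qed simp
  from square_integrable_mult_cnj[OF g this]
  show int: "integrable lborel (\<lambda>x. g x * ?I x)" by simp
  have "(\<lambda>n. \<integral>x. ?s n x \<partial>lborel) \<longlonglongrightarrow> (\<integral>x. g x * ?I x \<partial>lborel)"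
  proof (rule integral_dominated_convergence)
    show "integrable lborel (\<lambda>x. norm (g x * ?I x))"
      using int by (rule integrable_norm)
    show "?s n \<in> borel_measurable lborel" for n
      using square_integrable_mult_cnj[OF g test_functions_square_integrable[OF box_bump_test], of "real (Suc n)" a b]
      by (simp add: borel_measurable_integrable del: of_nat_Suc)
    have "(\<lambda>n. ?s n x) \<longlonglongrightarrow> g x * cnj (indicator (box a b) x)" for x
      by (intro tendsto_intros tendsto_cnj box_bump_tendsto)
    moreover have "cnj (indicator (box a b) x) = ?I x" for x
      by (simp add: indicator_def)
    ultimately show "AE x in lborel. (\<lambda>n. ?s n x) \<longlonglongrightarrow> g x * ?I x"
      by (simp only: AE_I2)
    show "AE x in lborel. norm (?s n x) \<le> norm (g x * ?I x)" for n
      using norm_box_bump[of "real (Suc n)" a b]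
      by (auto simp: norm_mult intro!: mult_left_mono)
  qed simp
  moreover have s0: "(\<integral>x. ?s n x \<partial>lborel) = 0" for n
    by (intro orth box_bump_test) simp
  ultimately show "(\<integral>x. g x * ?I x \<partial>lborel) = 0"
    unfolding s0 using LIMSEQ_unique[OF tendsto_const] by metis
qed

text \<open>Density in the dual form that the uniqueness of weak gradients requires. Real and
  imaginary parts are treated separately because the comparison of measures works with real
  densities.\<close>

lemma l2_eq_0_if_orthogonal:
  fixes h :: "(real ^ 'd::finite) l2"
  assumes orth: "\<And>\<phi>. \<phi> \<in> test_functions \<Longrightarrow> cinner_l2 h (abs_l2 \<phi>) = 0"
  shows "h = 0"
proof -
  define g where "g = rep_l2 h"
  have g: "square_integrable g" and h: "h = abs_l2 g"
    by (simp_all add: g_def square_integrable_rep_l2 abs_rep_l2)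
  have [measurable]: "g \<in> borel_measurable borel"
    using g by (simp add: square_integrable_def)
  have "(\<integral>x. g x * cnj (\<phi> x) \<partial>lborel) = 0" if "\<phi> \<in> test_functions" for \<phi>
    using orth[OF that] g that by (simp add: h cinner_abs_l2 test_functions_square_integrable)
  note * = box_integral_eq_0_if_orthogonal[OF g this]
  have re: "indicator (box a b) x * Re (g x) = Re (g x * of_real (indicator (box a b) x))"
    and im: "indicator (box a b) x * Im (g x) = Im (g x * of_real (indicator (box a b) x))" for a b x
    by simp_all
  have "AE x in lborel. Re (g x) = 0"
    by (rule AE_eq_0_if_box_integrals_eq_0) (simp_all only: re * integral_Re integrable_Re, simp_all)
  moreover have "AE x in lborel. Im (g x) = 0"
    by (rule AE_eq_0_if_box_integrals_eq_0) (simp_all only: im * integral_Im integrable_Im, simp_all)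
  ultimately have "AE x in lborel. g x = 0"
    by eventually_elim (simp add: complex_eq_iff)
  then have "l2rel g (\<lambda>x. 0)"
    using g by (simp add: l2rel_def square_integrable_0)
  then show "h = 0"
    by (simp add: h zero_l2_def Quotient3_rel_abs[OF Quotient3_l2])
qed

text \<open>If every test function were 0 in L2, every element of L2 would be orthogonal to all of
  them and hence 0, against the indicator of the unit cube, whose norm is 1. The function obtained
  serves as the envelope of the wave packets.\<close>

lemma exists_nonzero_test_function:
  "\<exists>\<eta> \<in> (test_functions :: (real ^ 'd::finite \<Rightarrow> complex) set). abs_l2 \<eta> \<noteq> 0"
proof (rule ccontr)
  assume "\<not> ?thesis"
  then have zero: "abs_l2 \<eta> = 0" if "\<eta> \<in> test_functions" for \<eta> :: "real ^ 'd \<Rightarrow> complex"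
    using that by blast
  let ?I = "indicator (cbox 0 1) :: real ^ 'd \<Rightarrow> complex"
  have "integrable lborel (indicator (cbox 0 1) :: real ^ 'd \<Rightarrow> real)"
    by (intro integrable_real_indicator emeasure_bounded_finite) auto
  also have eq: "indicator (cbox 0 1) = (\<lambda>x::real ^ 'd. (cmod (?I x))\<^sup>2)"
    by (auto simp: indicator_def)
  finally have I: "square_integrable ?I"
    by (simp add: square_integrable_def)
  have "abs_l2 ?I = 0"
    by (rule l2_eq_0_if_orthogonal) (subst cinner_l2_commute, simp add: zero cinner_l2_0_left)
  then have "measure lborel (cbox 0 1 :: (real ^ 'd) set) = 0"
    using norm_abs_l2[OF I] by (simp flip: eq)
  moreover have "cbox 0 1 \<noteq> ({} :: (real ^ 'd) set)"
    by (simp add: interval_ne_empty_cart)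
  then have "measure lborel (cbox 0 1 :: (real ^ 'd) set) = 1"
    using content_cbox_cart by fastforce
  ultimately show False by simp
qed

section \<open>Weak gradients and the spaces\<close>

lemma weak_gradient_unique:
  assumes "weak_gradient f v" "weak_gradient f w"
  shows "v = w"
proof -
  have "v $ i - w $ i = 0" for i
    using assms by (intro l2_eq_0_if_orthogonal) (simp add: weak_gradient_def cinner_l2_diff_left)
  then show ?thesis by (simp add: vec_eq_iff)
qed

lemma H1_to_W_eqI: "weak_gradient f v \<Longrightarrow> H1_to_W f = v"
  unfolding H1_to_W_def by (rule the_equality) (auto intro: weak_gradient_unique)

lemma weak_gradient_H1_to_W: "f \<in> H1 \<Longrightarrow> weak_gradient f (H1_to_W f)"
  by (auto simp: H1_def dest: H1_to_W_eqI)

lemma weak_gradient_test: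
  "f \<in> test_functions \<Longrightarrow> weak_gradient (abs_l2 f) (test_grad f)"
  by (simp add: weak_gradient_def test_grad_def integral_by_parts)

lemma abs_test_functions_H1: "f \<in> test_functions \<Longrightarrow> abs_l2 f \<in> H1"
  using weak_gradient_test by (auto simp: H1_def)

section \<open>Linear structure of \<open>W\<close> and of the energy space\<close>

lemma scaleC_l2_add_right: "c *\<^sub>C (f + g) = c *\<^sub>C f + c *\<^sub>C (g :: 'a::euclidean_space l2)"
  by transfer (auto simp: l2rel_def distrib_left intro!: square_integrable_cmult square_integrable_add)

lemma norm_scaleC_vfield: "norm (c *\<^sub>C v) = cmod c * norm (v :: 'd::finite vfield)"
  by (simp add: norm_vec_def scaleC_vec_def norm_scaleC_l2 L2_set_right_distrib)

lemma scaleR_vfield_eq_scaleC: "r *\<^sub>R v = complex_of_real r *\<^sub>C (v :: 'd::finite vfield)"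
  by (simp add: vec_eq_iff scaleC_vec_def scaleR_l2_eq_scaleC)

lemma scaleR_energy_eq_scaleC: "r *\<^sub>R v = complex_of_real r *\<^sub>C (v :: 'd::finite energy)"
  by (simp add: prod_eq_iff scaleC_prod_def scaleR_l2_eq_scaleC scaleR_vfield_eq_scaleC)

lemma bounded_linear_scaleC_vfield: "bounded_linear (\<lambda>v :: 'd::finite vfield. c *\<^sub>C v)"
proof (rule bounded_linear_intro[where K = "cmod c"])
  show "c *\<^sub>C (u + v) = c *\<^sub>C u + c *\<^sub>C v" for u v :: "'d vfield"
    by (simp add: vec_eq_iff scaleC_vec_def scaleC_l2_add_right)
  have "c *\<^sub>C r *\<^sub>R f = r *\<^sub>R c *\<^sub>C f" for r and f :: "(real ^ 'd) l2"
    by transfer (auto simp: l2rel_def intro!: square_integrable_cmult square_integrable_scaleR)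
  then show "c *\<^sub>C r *\<^sub>R v = r *\<^sub>R c *\<^sub>C v" for r and v :: "'d vfield"
    by (simp add: vec_eq_iff scaleC_vec_def)
  show "norm (c *\<^sub>C v) \<le> norm v * cmod c" for v :: "'d vfield"
    by (simp add: norm_scaleC_vfield)
qed

lemma test_grad_add:
  assumes "f \<in> test_functions" "g \<in> test_functions"
  shows "test_grad (\<lambda>x. f x + g x) = test_grad f + test_grad g"
proof -
  have "pd i (\<lambda>x. f x + g x) = (\<lambda>x. pd i f x + pd i g x)" for i
    using assms[THEN test_functionsD(1)] by (auto simp: pd_add smooth_differentiable)
  then show ?thesis
    using assms by (simp add: vec_eq_iff test_grad_def abs_l2_add test_functions_pd test_functions_square_integrable)
qed

lemma test_grad_cmult:
  assumes "f \<in> test_functions"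
  shows "test_grad (\<lambda>x. c * f x) = c *\<^sub>C test_grad f"
proof -
  have "pd i (\<lambda>x. c * f x) = (\<lambda>x. c * pd i f x)" for i
    using assms[THEN test_functionsD(1)] by (auto simp: pd_cmult smooth_differentiable)
  then show ?thesis
    using assms by (simp add: vec_eq_iff test_grad_def scaleC_vec_def abs_l2_cmult test_functions_pd test_functions_square_integrable)
qed

lemma test_grad_in_W: "f \<in> test_functions \<Longrightarrow> test_grad f \<in> W"
  unfolding W_def by (rule subsetD[OF closure_subset]) (rule imageI)

lemma W_scaleC:
  assumes "u \<in> W"
  shows "c *\<^sub>C u \<in> W"
proof -
  have "(\<lambda>v. c *\<^sub>C v) ` test_grad ` test_functions \<subseteq> test_grad ` test_functions"
    by (auto simp: test_functions_cmult simp flip: test_grad_cmult)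
  then have "closure ((\<lambda>v. c *\<^sub>C v) ` test_grad ` test_functions) \<subseteq> W"
    unfolding W_def by (rule closure_mono)
  moreover have "c *\<^sub>C u \<in> (\<lambda>v. c *\<^sub>C v) ` closure (test_grad ` test_functions)"
    using assms by (auto simp: W_def)
  ultimately show ?thesis
    using closure_bounded_linear_image_subset[OF bounded_linear_scaleC_vfield] by blast
qed

lemma W_add:
  assumes "u \<in> W" "v \<in> W"
  shows "u + v \<in> W"
proof -
  obtain x y where xy: "\<forall>n. x n \<in> test_grad ` test_functions" "x \<longlonglongrightarrow> u"
    "\<forall>n. y n \<in> test_grad ` test_functions" "y \<longlonglongrightarrow> v"
    using assms unfolding W_def closure_sequential by blast
  have "a + b \<in> test_grad ` test_functions"
    if "a \<in> test_grad ` test_functions" "b \<in> test_grad ` test_functions" for a b :: "'a vfield"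
    using that by (auto simp: test_functions_add simp flip: test_grad_add)
  then have "\<forall>n. x n + y n \<in> test_grad ` test_functions"
    using xy by blast
  moreover have "(\<lambda>n. x n + y n) \<longlonglongrightarrow> u + v"
    using xy by (intro tendsto_add)
  ultimately show ?thesis
    unfolding W_def closure_sequential by (intro exI[of _ "\<lambda>n. x n + y n"] conjI)
qed

lemma W_diff: "u \<in> W \<Longrightarrow> v \<in> W \<Longrightarrow> u - v \<in> W"
  using W_add[OF _ W_scaleC, of u v "of_real (-1)"] scaleR_vfield_eq_scaleC[of "-1" v]
  by (simp del: of_real_minus of_real_1 flip: scaleR_vfield_eq_scaleC)

lemma W_0: "0 \<in> (W :: 'd::finite vfield set)"
proof -
  have "test_functions \<noteq> ({} :: (real ^ 'd \<Rightarrow> complex) set)"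
    using exists_nonzero_test_function by blast
  then obtain u :: "'d vfield" where "u \<in> W"
    using test_grad_in_W by blast
  then show "0 \<in> (W :: 'd vfield set)"
    using W_diff[of u u] by simp
qed

lemma energy_space_add: "x \<in> energy_space \<Longrightarrow> y \<in> energy_space \<Longrightarrow> x + y \<in> energy_space"
  by (auto simp: energy_space_def W_add)

lemma energy_space_scaleC: "x \<in> energy_space \<Longrightarrow> c *\<^sub>C x \<in> energy_space"
  by (auto simp: energy_space_def scaleC_prod_def W_scaleC)

section \<open>Functionals on \<open>W\<close> and their norms\<close>

lemma extends_to_W_unique:
  assumes "extends_to_W h l" "extends_to_W h m"
  shows "l = m"
proof -
  have lm: "l \<in> W_dual" "m \<in> W_dual" and eq: "\<And>\<phi>. \<phi> \<in> test_functions \<Longrightarrow> l (test_grad \<phi>) = m (test_grad \<phi>)"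
    using assms by (auto simp: extends_to_W_def)
  obtain C D where C: "\<And>u. u \<in> W \<Longrightarrow> cmod (l u) \<le> C * norm u"
    and D: "\<And>u. u \<in> W \<Longrightarrow> cmod (m u) \<le> D * norm u"
    using lm unfolding W_dual_def by blast
  have add: "l (u + v) = l u + l v" "m (u + v) = m u + m v" if "u \<in> W" "v \<in> W" for u v
    using lm that by (auto simp: W_dual_def)
  show ?thesis
  proof (rule extensionalityI)
    show "l \<in> extensional W" "m \<in> extensional W"
      using lm by (auto simp: W_dual_def)
    fix u :: "'a vfield" assume u: "u \<in> W"
    then obtain x where x: "\<forall>n. x n \<in> test_grad ` test_functions" "x \<longlonglongrightarrow> u"
      unfolding W_def closure_sequential by blast
    \<comment> \<open>Both functionals agree at \<open>x n\<close>, so their difference at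
      \<open>u\<close> sees only the distance from \<open>u\<close> to the dense set.\<close>
    have "cmod (l u - m u) \<le> (C + D) * norm (u - x n)" for n
    proof -
      obtain \<phi> where \<phi>: "\<phi> \<in> test_functions" "x n = test_grad \<phi>" using x(1) by blast
      have xW: "x n \<in> W" and "l (x n) = m (x n)" using \<phi> eq test_grad_in_W by auto
      with xW have "l u - m u = l (u - x n) - m (u - x n)"
        using add[OF W_diff[OF u xW] xW] by simp
      also have "cmod \<dots> \<le> C * norm (u - x n) + D * norm (u - x n)"
        by (intro order_trans[OF norm_triangle_ineq4] add_mono C D W_diff u xW)
      finally show ?thesis by (simp add: distrib_right)
    qed
    moreover have "(\<lambda>n. (C + D) * norm (u - x n)) \<longlonglongrightarrow> (C + D) * norm (u - u)"
      by (intro tendsto_intros x)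
    ultimately have "cmod (l u - m u) \<le> (C + D) * norm (u - u)"
      by (intro LIMSEQ_le_const) auto
    then show "l u = m u" by simp
  qed
qed

lemma W_functional_eqI: "extends_to_W h l \<Longrightarrow> W_functional h = l"
  unfolding W_functional_def by (rule the_equality) (auto intro: extends_to_W_unique)

text \<open>Since elements of \<open>W\<close> are represented by their gradients, the extension can
  be written down: after integration by parts the pairing depends on the i-th component of the
  gradient alone and makes sense for every \<open>v\<close> in \<open>W\<close>. No embedding of
  \<open>W\<close> into a function space is involved, so the dimension is arbitrary.\<close>

lemma extends_to_W_pd:
  assumes "\<psi> \<in> test_functions"
  shows "extends_to_W (abs_l2 (pd i \<psi>)) (\<lambda>v\<in>W. - cinner_l2 (abs_l2 \<psi>) (v $ i))"
  unfolding extends_to_W_def W_dual_def mem_Collect_eq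
proof (intro conjI ballI allI exI)
  fix u :: "'a vfield" assume "u \<in> W"
  have "cmod (cinner_l2 (abs_l2 \<psi>) (u $ i)) \<le> norm (abs_l2 \<psi>) * norm u"
    by (rule order_trans[OF cmod_cinner_l2_le]) (simp add: mult_left_mono Finite_Cartesian_Product.norm_nth_le)
  then show "cmod ((\<lambda>v\<in>W. - cinner_l2 (abs_l2 \<psi>) (v $ i)) u) \<le> norm (abs_l2 \<psi>) * norm u"
    using \<open>u \<in> W\<close> by simp
next
  fix \<phi> :: "real ^ 'a \<Rightarrow> complex" assume "\<phi> \<in> test_functions"
  then show "(\<lambda>v\<in>W. - cinner_l2 (abs_l2 \<psi>) (v $ i)) (test_grad \<phi>) = cinner_l2 (abs_l2 (pd i \<psi>)) (abs_l2 \<phi>)"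
    using assms test_grad_in_W[of \<phi>] by (simp add: test_grad_def integral_by_parts)
next
  fix c and u :: "'a vfield" assume "u \<in> W"
  then show "(\<lambda>v\<in>W. - cinner_l2 (abs_l2 \<psi>) (v $ i)) (c *\<^sub>C u)
      = cnj c * (\<lambda>v\<in>W. - cinner_l2 (abs_l2 \<psi>) (v $ i)) u"
    using W_scaleC[of u c] by (simp add: scaleC_vec_def cinner_l2_scaleC_right)
qed (simp_all add: W_add cinner_l2_add_right)

text \<open>An upper bound suffices because the norm of the data stands on the larger side of the
  decay estimates.\<close>

lemma W_dual_norm_pd_le:
  assumes "\<psi> \<in> test_functions"
  shows "W_dual_norm (W_functional (abs_l2 (pd i \<psi>))) \<le> norm (abs_l2 \<psi>)"
  unfolding W_functional_eqI[OF extends_to_W_pd[OF assms]] W_dual_norm_def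
proof (rule cSUP_least)
  show "{u \<in> W. norm u \<le> 1} \<noteq> ({} :: 'a vfield set)"
    using W_0 by force
  fix u :: "'a vfield" assume u: "u \<in> {u \<in> W. norm u \<le> 1}"
  have "cmod (cinner_l2 (abs_l2 \<psi>) (u $ i)) \<le> norm (abs_l2 \<psi>) * norm (u $ i)"
    by (rule cmod_cinner_l2_le)
  also have "\<dots> \<le> norm (abs_l2 \<psi>) * 1"
    using u by (intro mult_left_mono order_trans[OF Finite_Cartesian_Product.norm_nth_le]) auto
  finally show "cmod ((\<lambda>v\<in>W. - cinner_l2 (abs_l2 \<psi>) (v $ i)) u) \<le> norm (abs_l2 \<psi>)"
    using u by simp
qed

text \<open>Allows the upper bound on the dual norm to be squared. The norm is a supremum of reals,
  so the set of values has to be shown bounded before the value at 0 can be compared with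
  it.\<close>

lemma W_dual_norm_nonneg:
  assumes "l \<in> W_dual"
  shows "0 \<le> W_dual_norm l"
proof -
  obtain C where C: "\<And>u. u \<in> W \<Longrightarrow> cmod (l u) \<le> C * norm u"
    using assms unfolding W_dual_def by blast
  have "cmod (l u) \<le> \<bar>C\<bar>" if "u \<in> W" "norm u \<le> 1" for u
  proof -
    have "cmod (l u) \<le> \<bar>C\<bar> * norm u"
      using C[OF that(1)] by (rule order_trans) (simp add: mult_right_mono)
    also have "\<dots> \<le> \<bar>C\<bar> * 1" using that by (intro mult_left_mono) auto
    finally show ?thesis by simp
  qed
  then have "bdd_above ((\<lambda>u. cmod (l u)) ` {u \<in> W. norm u \<le> 1})"
    by (intro bdd_aboveI[of _ "\<bar>C\<bar>"]) auto
  then have "cmod (l 0) \<le> W_dual_norm l"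
    unfolding W_dual_norm_def by (intro cSUP_upper) (auto simp: W_0)
  then show ?thesis using norm_ge_zero order_trans by blast
qed

section \<open>Approximate eigenvectors of a generator\<close>

text \<open>
  The error $\|T(s)x-e^{\mu s}x\|$ is subadditive in $s$, hence at most $t$ times its right
  derivative at zero.
\<close>

lemma semigroup_approximate_eigenvector:
  fixes T :: "real \<Rightarrow> 'h \<Rightarrow> 'h::{real_normed_vector, scaleC}"
  assumes sg: "C0_contraction_semigroup X T" and gen: "(x, y) \<in> generator X T"
    and X: "\<And>a b. a \<in> X \<Longrightarrow> b \<in> X \<Longrightarrow> a + b \<in> X" "\<And>c a. a \<in> X \<Longrightarrow> c *\<^sub>C a \<in> X"
    and scaleR: "\<And>r (a::'h). r *\<^sub>R a = complex_of_real r *\<^sub>C a"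
    and "\<mu> \<le> 0" "t > 0"
  shows "norm (T t x - exp (\<mu> * t) *\<^sub>R x) \<le> t * norm (y - \<mu> *\<^sub>R x)"
proof -
  define \<phi> where "\<phi> s = norm (T s x - exp (\<mu> * s) *\<^sub>R x)" for s
  have x: "x \<in> X" and lim: "((\<lambda>t. (T t x - x) /\<^sub>R t) \<longlongrightarrow> y) (at_right 0)"
    using gen by (auto simp: generator_def)
  have TX: "T s a \<in> X" and T_add: "b \<in> X \<Longrightarrow> T s (a + b) = T s a + T s b"
    and T_scale: "T s (c *\<^sub>C a) = c *\<^sub>C T s a" and T_le: "norm (T s a) \<le> norm a"
    and T_0: "T 0 a = a" and T_comp: "r \<ge> 0 \<Longrightarrow> T (s + r) a = T s (T r a)"
    if "s \<ge> 0" "a \<in> X" for s a b c r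
    using sg that by (auto simp: C0_contraction_semigroup_def)
  have XR: "r *\<^sub>R a \<in> X" if "a \<in> X" for r a
    using that X(2) by (simp add: scaleR)
  have T_diff: "T s (a - b) = T s a - T s b" if "s \<ge> 0" "a \<in> X" "b \<in> X" for s a b
    using T_add[OF that(1,2) XR[OF that(3)], of "-1"] T_scale[OF that(1,3), of "of_real (-1)"]
    by (simp del: of_real_minus of_real_1 flip: scaleR)
  have XD: "a - b \<in> X" if "a \<in> X" "b \<in> X" for a b
    using X(1)[OF that(1) XR[OF that(2), of "-1"]] by simp
  have sub: "\<phi> (s + r) \<le> \<phi> s + \<phi> r" if "s \<ge> 0" "r \<ge> 0" for s r
  proof -
    \<comment> \<open>Contractivity bounds the first summand by \<open>\<phi> r\<close>, and \<mu>
      \<le> 0 bounds the factor in front of the second one by 1.\<close>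
    have "T (s + r) x - exp (\<mu> * (s + r)) *\<^sub>R x
        = T s (T r x - exp (\<mu> * r) *\<^sub>R x) + exp (\<mu> * r) *\<^sub>R (T s x - exp (\<mu> * s) *\<^sub>R x)"
      using that x T_scale[OF that(1) x, of "of_real (exp (\<mu> * r))"]
      by (simp add: T_comp[of s x r] T_diff TX XR scaleR[symmetric] scaleR_diff_right distrib_left exp_add
          mult.commute[of "exp (\<mu> * s)"])
    also have "norm \<dots> \<le> norm (T s (T r x - exp (\<mu> * r) *\<^sub>R x)) + exp (\<mu> * r) * \<phi> s"
      by (rule order_trans[OF norm_triangle_ineq]) (simp add: \<phi>_def)
    also have "\<dots> \<le> \<phi> r + 1 * \<phi> s"
      using that \<open>\<mu> \<le> 0\<close> x unfolding \<phi>_def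
      by (intro add_mono mult_right_mono T_le XD TX XR) (auto simp: mult_nonpos_nonneg)
    finally show ?thesis by (simp add: \<phi>_def)
  qed
  have mult: "\<phi> (real n * s) \<le> real n * \<phi> s" if "s \<ge> 0" for n s
  proof (induction n)
    case 0
    then show ?case using T_0[OF order_refl x] by (simp add: \<phi>_def)
  next
    case (Suc n)
    have "\<phi> (real (Suc n) * s) \<le> \<phi> (real n * s) + \<phi> s"
      using sub[of "real n * s" s] that by (simp add: algebra_simps)
    with Suc show ?case by (simp add: algebra_simps)
  qed
  have "((\<lambda>h. (exp (\<mu> * h) - 1) / h) \<longlongrightarrow> \<mu>) (at_right 0)"
  proof -
    have "((\<lambda>h. exp (\<mu> * h)) has_real_derivative \<mu>) (at 0)"
      by (auto intro!: derivative_eq_intros)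
    then have "((\<lambda>h. (exp (\<mu> * h) - 1) / h) \<longlongrightarrow> \<mu>) (at 0)"
      by (simp add: DERIV_def)
    then show ?thesis by (rule filterlim_mono) (auto simp: at_within_le_at)
  qed
  then have "((\<lambda>h. norm ((T h x - x) /\<^sub>R h - ((exp (\<mu> * h) - 1) / h) *\<^sub>R x)) \<longlongrightarrow> norm (y - \<mu> *\<^sub>R x)) (at_right 0)"
    by (intro tendsto_intros lim)
  moreover have "eventually (\<lambda>h. norm ((T h x - x) /\<^sub>R h - ((exp (\<mu> * h) - 1) / h) *\<^sub>R x) = \<phi> h / h) (at_right 0)"
    unfolding eventually_at_right_field
  proof (intro exI[of _ 1] conjI allI impI)
    fix h :: real assume h: "0 < h"
    have "(T h x - x) /\<^sub>R h - ((exp (\<mu> * h) - 1) / h) *\<^sub>R x = (T h x - exp (\<mu> * h) *\<^sub>R x) /\<^sub>R h"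
      by (simp add: divide_inverse algebra_simps)
    then show "norm ((T h x - x) /\<^sub>R h - ((exp (\<mu> * h) - 1) / h) *\<^sub>R x) = \<phi> h / h"
      using h by (simp add: \<phi>_def divide_inverse)
  qed simp
  ultimately have "((\<lambda>h. \<phi> h / h) \<longlongrightarrow> norm (y - \<mu> *\<^sub>R x)) (at_right 0)"
    by (rule Lim_transform_eventually)
  moreover have "filterlim (\<lambda>n. t / real (Suc n)) (at_right 0) sequentially"
  proof -
    have "(\<lambda>n. t * inverse (real (Suc n))) \<longlonglongrightarrow> t * 0"
      by (intro tendsto_intros LIMSEQ_inverse_real_of_nat)
    then show ?thesis
      using \<open>t > 0\<close> by (auto simp: filterlim_at divide_inverse)
  qed
  ultimately have "(\<lambda>n. \<phi> (t / real (Suc n)) / (t / real (Suc n))) \<longlonglongrightarrow> norm (y - \<mu> *\<^sub>R x)"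
    by (rule filterlim_compose)
  then have "(\<lambda>n. t * (\<phi> (t / real (Suc n)) / (t / real (Suc n)))) \<longlonglongrightarrow> t * norm (y - \<mu> *\<^sub>R x)"
    by (intro tendsto_intros)
  \<comment> \<open>Cutting [0, t] into n+1 steps of length h = t/(n+1) gives \<phi> t \<le> (n+1)
    \<phi> h = t (\<phi> h / h). The limit takes the place of the integral in Duhamel's
    formula.\<close>
  moreover have "\<phi> t \<le> t * (\<phi> (t / real (Suc n)) / (t / real (Suc n)))" for n
    using mult[of "t / real (Suc n)" "Suc n"] \<open>t > 0\<close> by (simp del: of_nat_Suc add: mult.commute)
  ultimately show ?thesis
    unfolding \<phi>_def[symmetric] by (intro LIMSEQ_le_const) auto
qed

section \<open>Approximate solutions of the damped wave equation\<close>

lemma cinner_l2_sum_left: "cinner_l2 (\<Sum>j\<in>A. f j) g = (\<Sum>j\<in>A. cinner_l2 (f j) g)"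
  by (induction A rule: infinite_finite_induct) (simp_all add: cinner_l2_0_left cinner_l2_add_left)

lemma cinner_l2_scaleR_left: "cinner_l2 (r *\<^sub>R f) g = of_real r * cinner_l2 f g"
  by (simp add: scaleR_l2_eq_scaleC cinner_l2_scaleC_left)

text \<open>The Laplacian computed by classical derivatives, as an element of L2, whereas
  \<open>Laplacian\<close> produces a functional on \<open>W\<close>.\<close>

definition laplace :: "(real ^ 'd::finite \<Rightarrow> complex) \<Rightarrow> (real ^ 'd) l2" where
  "laplace f = (\<Sum>j\<in>UNIV. abs_l2 (pd j (pd j f)))"

lemma Laplacian_test_grad:
  assumes "f \<in> test_functions" "\<phi> \<in> test_functions"
  shows "Laplacian (test_grad f) (test_grad \<phi>) = cinner_l2 (laplace f) (abs_l2 \<phi>)"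
  using assms test_grad_in_W[OF assms(2)]
  by (simp add: Laplacian_def cinner_vec_def test_grad_def laplace_def cinner_l2_sum_left
      integral_by_parts test_functions_pd sum_negf)

lemma abs_l2_scaleR:
  "square_integrable f \<Longrightarrow> abs_l2 (\<lambda>x. of_real r * f x) = r *\<^sub>R abs_l2 f"
  by (simp add: abs_l2_cmult scaleR_l2_eq_scaleC)

text \<open>Puts the data into the domain of the generator, where the orbit has a right derivative
  at time 0, as the estimate for approximate eigenvectors requires.\<close>

lemma wave_operator_test:
  assumes f: "f \<in> test_functions"
  shows "((test_grad f, \<mu> *\<^sub>R abs_l2 f), (\<mu> *\<^sub>R test_grad f, laplace f - \<mu> *\<^sub>R abs_l2 f))
    \<in> wave_operator"
proof -
  let ?g = "\<lambda>x. of_real \<mu> * f x"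
  have g: "?g \<in> test_functions" by (rule test_functions_cmult[OF f])
  have g_eq: "abs_l2 ?g = \<mu> *\<^sub>R abs_l2 f"
    by (rule abs_l2_scaleR[OF test_functions_square_integrable[OF f]])
  have H: "\<mu> *\<^sub>R abs_l2 f \<in> H1"
    using abs_test_functions_H1[OF g] by (simp add: g_eq)
  have "H1_to_W (\<mu> *\<^sub>R abs_l2 f) = \<mu> *\<^sub>R test_grad f"
    using H1_to_W_eqI[OF weak_gradient_test[OF g]]
    by (simp add: g_eq test_grad_cmult[OF f] scaleR_vfield_eq_scaleC)
  moreover have "Laplacian_minus_eq (test_grad f) (\<mu> *\<^sub>R abs_l2 f) (laplace f - \<mu> *\<^sub>R abs_l2 f)"
    by (simp add: Laplacian_minus_eq_def Laplacian_test_grad f cinner_l2_diff_left)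
  ultimately show ?thesis
    using H test_grad_in_W[OF f] unfolding wave_operator_def by force
qed

text \<open>With \<mu> f as velocity the first component of the residual cancels exactly. In the
  second one the characteristic equation replaces \<mu>^2 + \<mu> by -\<kappa>^2, so only the defect
  of f as an eigenfunction of the Laplacian remains.\<close>

lemma wave_semigroup_approximation:
  assumes gen: "generates energy_space wave_operator T" and f: "f \<in> test_functions"
    and \<mu>: "\<mu>\<^sup>2 + \<mu> + \<kappa>\<^sup>2 = 0" "\<mu> \<le> 0" and "t > 0"
  shows "norm (T t (test_grad f, \<mu> *\<^sub>R abs_l2 f) - exp (\<mu> * t) *\<^sub>R (test_grad f, \<mu> *\<^sub>R abs_l2 f))
    \<le> t * norm (laplace f + \<kappa>\<^sup>2 *\<^sub>R abs_l2 f)"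
proof -
  let ?x = "(test_grad f, \<mu> *\<^sub>R abs_l2 f)" and ?y = "(\<mu> *\<^sub>R test_grad f, laplace f - \<mu> *\<^sub>R abs_l2 f)"
  have "(?x, ?y) \<in> generator energy_space T"
    using gen wave_operator_test[OF f] by (simp add: generates_def)
  then have "norm (T t ?x - exp (\<mu> * t) *\<^sub>R ?x) \<le> t * norm (?y - \<mu> *\<^sub>R ?x)"
    using gen \<mu>(2) \<open>t > 0\<close> unfolding generates_def
    by (intro semigroup_approximate_eigenvector)
      (auto intro: energy_space_add energy_space_scaleC scaleR_energy_eq_scaleC)
  also have "?y - \<mu> *\<^sub>R ?x = (0, laplace f - (\<mu>\<^sup>2 + \<mu>) *\<^sub>R abs_l2 f)"
    by (simp add: power2_eq_square algebra_simps)
  also have "\<mu>\<^sup>2 + \<mu> = - (\<kappa>\<^sup>2)"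
    using \<mu>(1) by simp
  finally show ?thesis by simp
qed

text \<open>The velocity is a multiple of f, so the sum of the data is (1 + \<mu>) f, again a
  derivative of a test function; this gives membership in \<open>K_space\<close> and the last term
  of the bound.\<close>

lemma slow_data:
  fixes i :: "'d::finite" and \<mu> :: real
  assumes \<psi>: "\<psi> \<in> test_functions"
  defines "f \<equiv> pd i \<psi>"
  defines "F \<equiv> (abs_l2 f, \<mu> *\<^sub>R abs_l2 f)"
  shows "F \<in> K_space" and "data_to_energy F = (test_grad f, \<mu> *\<^sub>R abs_l2 f)"
    and "K_norm F \<le> sqrt ((norm (test_grad f))\<^sup>2 + (\<mu>\<^sup>2 + 1) * (norm (abs_l2 f))\<^sup>2 + ((1 + \<mu>) * norm (abs_l2 \<psi>))\<^sup>2)"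
proof -
  let ?\<psi> = "\<lambda>x. of_real (1 + \<mu>) * \<psi> x"
  have f: "f \<in> test_functions"
    unfolding f_def by (rule test_functions_pd[OF \<psi>])
  note si = test_functions_square_integrable
  have \<psi>': "?\<psi> \<in> test_functions" by (rule test_functions_cmult[OF \<psi>])
  have "pd i ?\<psi> = (\<lambda>x. of_real (1 + \<mu>) * f x)"
    using \<psi> by (simp add: fun_eq_iff f_def pd_cmult smooth_differentiable test_functionsD)
  then have sum: "abs_l2 f + \<mu> *\<^sub>R abs_l2 f = abs_l2 (pd i ?\<psi>)"
    by (simp add: abs_l2_scaleR[OF si[OF f]] scaleR_add_left del: of_real_add)
  show K: "F \<in> K_space"
    using abs_test_functions_H1[OF f] extends_to_W_pd[OF \<psi>', of i]
    by (auto simp: K_space_def F_def sum)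
  show E: "data_to_energy F = (test_grad f, \<mu> *\<^sub>R abs_l2 f)"
    by (simp add: data_to_energy_def F_def H1_to_W_eqI[OF weak_gradient_test[OF f]])
  have "W_dual_norm (W_functional (abs_l2 (pd i ?\<psi>))) \<le> \<bar>1 + \<mu>\<bar> * norm (abs_l2 \<psi>)"
    using W_dual_norm_pd_le[OF \<psi>', of i] unfolding abs_l2_scaleR[OF si[OF \<psi>]] norm_scaleR .
  moreover have "0 \<le> W_dual_norm (W_functional (abs_l2 (pd i ?\<psi>)))"
    using extends_to_W_pd[OF \<psi>', of i] W_functional_eqI[OF extends_to_W_pd[OF \<psi>', of i]]
    by (intro W_dual_norm_nonneg) (simp add: extends_to_W_def)
  ultimately have "(W_dual_norm (W_functional (abs_l2 (pd i ?\<psi>))))\<^sup>2 \<le> (\<bar>1 + \<mu>\<bar> * norm (abs_l2 \<psi>))\<^sup>2"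
    by (rule power_mono)
  then have D: "(W_dual_norm (W_functional (abs_l2 (pd i ?\<psi>))))\<^sup>2 \<le> ((1 + \<mu>) * norm (abs_l2 \<psi>))\<^sup>2"
    by (simp add: power_mult_distrib)
  have "K_norm F = sqrt ((norm (data_to_energy F))\<^sup>2 + (norm (abs_l2 f))\<^sup>2
      + (W_dual_norm (W_functional (abs_l2 (pd i ?\<psi>))))\<^sup>2)"
    by (simp add: K_norm_def F_def sum)
  also have "\<dots> \<le> sqrt ((norm (test_grad f))\<^sup>2 + (\<mu>\<^sup>2 + 1) * (norm (abs_l2 f))\<^sup>2 + ((1 + \<mu>) * norm (abs_l2 \<psi>))\<^sup>2)"
    using D by (simp add: E norm_prod_def power_mult_distrib distrib_right)
  finally show "K_norm F \<le> \<dots>" .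
qed

text \<open>
  The bound in $L^2$ comes from testing the weak gradient of $v=u(t)$ against $\psi$:
  $\langle v,f\rangle=-\langle\partial_i v,\psi\rangle\approx e^{\mu t}\|f\|^2$ for $f=\partial_i\psi$.
\<close>

lemma decay_rates_ge_approximate:
  fixes T :: "real \<Rightarrow> 'd::finite energy \<Rightarrow> 'd energy" and i :: 'd
  assumes gen: "generates energy_space wave_operator T"
    and \<mu>: "\<mu>\<^sup>2 + \<mu> + \<kappa>\<^sup>2 = 0" "\<mu> \<le> 0" and t: "t > 0"
    and r: "r0 \<ge> 0" "r1 \<ge> 0" "r2 \<ge> 0"
    and r0: "\<And>F. F \<in> K_space \<Longrightarrow> L2_norm_le (mild_solution T F t) (r0 * K_norm F)"
    and r1: "\<And>F. F \<in> K_space \<Longrightarrow> norm (mild_solution T F t) \<le> r1 * K_norm F"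
    and r2: "\<And>F. F \<in> K_space \<Longrightarrow> norm (mild_solution_dt T F t) \<le> r2 * K_norm F"
    and \<psi>: "\<psi> \<in> test_functions"
  defines "f \<equiv> pd i \<psi>"
  defines "\<delta> \<equiv> t * norm (laplace f + \<kappa>\<^sup>2 *\<^sub>R abs_l2 f)"
  defines "K \<equiv> sqrt ((norm (test_grad f))\<^sup>2 + (\<mu>\<^sup>2 + 1) * (norm (abs_l2 f))\<^sup>2 + ((1 + \<mu>) * norm (abs_l2 \<psi>))\<^sup>2)"
  shows "exp (\<mu> * t) * (norm (abs_l2 f))\<^sup>2 - \<delta> * norm (abs_l2 \<psi>) \<le> r0 * K * norm (abs_l2 f)"
    and "exp (\<mu> * t) * norm (test_grad f) - \<delta> \<le> r1 * K"
    and "exp (\<mu> * t) * (- \<mu> * norm (abs_l2 f)) - \<delta> \<le> r2 * K"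
proof -
  define e where "e = exp (\<mu> * t)"
  define F where "F = (abs_l2 f, \<mu> *\<^sub>R abs_l2 f)"
  define u w where "u = mild_solution T F t" and "w = mild_solution_dt T F t"
  have f: "f \<in> test_functions"
    unfolding f_def by (rule test_functions_pd[OF \<psi>])
  have F: "F \<in> K_space" "data_to_energy F = (test_grad f, \<mu> *\<^sub>R abs_l2 f)" "K_norm F \<le> K"
    using slow_data[OF \<psi>, of i \<mu>] unfolding F_def K_def f_def by auto
  have "(u, w) = T t (data_to_energy F)"
    by (simp add: u_def w_def mild_solution_def mild_solution_dt_def)
  then have "norm ((u, w) - e *\<^sub>R (test_grad f, \<mu> *\<^sub>R abs_l2 f)) \<le> \<delta>"
    unfolding F(2) e_def \<delta>_def using wave_semigroup_approximation[OF gen f \<mu> t] by simp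
  then have d: "norm (u - e *\<^sub>R test_grad f, w - e *\<^sub>R \<mu> *\<^sub>R abs_l2 f) \<le> \<delta>"
    by simp
  have du: "norm (u - e *\<^sub>R test_grad f) \<le> \<delta>" and dw: "norm (w - e *\<^sub>R \<mu> *\<^sub>R abs_l2 f) \<le> \<delta>"
    by (rule order_trans[OF _ d], rule norm_fst_le norm_snd_le)+
  have "e * norm (test_grad f) \<le> norm u + \<delta>"
    using norm_triangle_sub[of "e *\<^sub>R test_grad f" u] du by (simp add: norm_minus_commute e_def)
  moreover have "norm u \<le> r1 * K"
    using r1[OF F(1)] mult_left_mono[OF F(3) r(2)] by (simp add: u_def)
  ultimately show "exp (\<mu> * t) * norm (test_grad f) - \<delta> \<le> r1 * K"
    by (simp add: e_def)
  have "e * (- \<mu> * norm (abs_l2 f)) \<le> norm w + \<delta>"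
    using norm_triangle_sub[of "e *\<^sub>R \<mu> *\<^sub>R abs_l2 f" w] dw \<mu>(2)
    by (simp add: norm_minus_commute e_def abs_mult abs_of_nonpos)
  moreover have "norm w \<le> r2 * K"
    using r2[OF F(1)] mult_left_mono[OF F(3) r(3)] by (simp add: w_def)
  ultimately show "exp (\<mu> * t) * (- \<mu> * norm (abs_l2 f)) - \<delta> \<le> r2 * K"
    by (simp add: e_def)
  \<comment> \<open>The semigroup estimate controls the gradient and the time derivative but not the
    L2 norm of the solution, so the latter is reached by duality through its weak gradient.\<close>
  obtain v where v: "v \<in> H1" "H1_to_W v = u" "norm v \<le> r0 * K_norm F"
    using r0[OF F(1)] by (auto simp: L2_norm_le_def u_def)
  let ?d = "u - e *\<^sub>R test_grad f"
  have "weak_gradient v u"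
    using weak_gradient_H1_to_W[OF v(1)] v(2) by simp
  then have "cinner_l2 v (abs_l2 f) = - cinner_l2 (u $ i) (abs_l2 \<psi>)"
    using \<psi> by (simp add: weak_gradient_def f_def)
  also have "u $ i = ?d $ i + e *\<^sub>R abs_l2 (pd i f)"
    by (simp add: test_grad_def)
  also have "cinner_l2 \<dots> (abs_l2 \<psi>) = cinner_l2 (?d $ i) (abs_l2 \<psi>) - of_real (e * (norm (abs_l2 f))\<^sup>2)"
    using integral_by_parts[OF f \<psi>, of i]
    by (simp add: cinner_l2_add_left cinner_l2_scaleR_left f_def[symmetric] cinner_l2_self_norm)
  finally have "of_real (e * (norm (abs_l2 f))\<^sup>2) = cinner_l2 v (abs_l2 f) + cinner_l2 (?d $ i) (abs_l2 \<psi>)"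
    by (simp add: algebra_simps)
  then have "cmod (of_real (e * (norm (abs_l2 f))\<^sup>2)) \<le> cmod (cinner_l2 v (abs_l2 f)) + cmod (cinner_l2 (?d $ i) (abs_l2 \<psi>))"
    using norm_triangle_ineq by metis
  then have "e * (norm (abs_l2 f))\<^sup>2 \<le> cmod (cinner_l2 v (abs_l2 f)) + cmod (cinner_l2 (?d $ i) (abs_l2 \<psi>))"
    unfolding norm_of_real by (simp add: e_def)
  also have "\<dots> \<le> norm v * norm (abs_l2 f) + norm (?d $ i) * norm (abs_l2 \<psi>)"
    by (intro add_mono cmod_cinner_l2_le)
  also have "\<dots> \<le> r0 * K * norm (abs_l2 f) + \<delta> * norm (abs_l2 \<psi>)"
    using v(3) mult_left_mono[OF F(3) r(1)]
    by (intro add_mono mult_right_mono order_trans[OF Finite_Cartesian_Product.norm_nth_le du]) auto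
  finally show "exp (\<mu> * t) * (norm (abs_l2 f))\<^sup>2 - \<delta> * norm (abs_l2 \<psi>) \<le> r0 * K * norm (abs_l2 f)"
    by (simp add: e_def)
qed

section \<open>Wave packets\<close>

text \<open>A plane wave in direction \<open>i\<close> with the dilated envelope
  \<theta>(\<epsilon>x). The square root of \<epsilon>^d keeps the L2 norm independent of
  \<epsilon>.\<close>

definition packet :: "real \<Rightarrow> 'd::finite \<Rightarrow> real \<Rightarrow> (real ^ 'd \<Rightarrow> complex) \<Rightarrow> real ^ 'd \<Rightarrow> complex" where
  "packet \<kappa> i \<epsilon> \<theta> x = (of_real (sqrt (\<epsilon> ^ CARD('d))) * cis (\<kappa> * x $ i)) * \<theta> (\<epsilon> *\<^sub>R x)"

text \<open>The derivative \<open>pd j\<close> transported to the envelope: commuting it with the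
  plane wave adds i\<kappa> in direction \<open>i\<close>, commuting it with the dilation gives the
  factor \<epsilon>.\<close>

definition packet_pd :: "real \<Rightarrow> 'd::finite \<Rightarrow> real \<Rightarrow> 'd \<Rightarrow> (real ^ 'd \<Rightarrow> complex) \<Rightarrow> real ^ 'd \<Rightarrow> complex" where
  "packet_pd \<kappa> i \<epsilon> j \<theta> x = of_real (if j = i then \<kappa> else 0) * \<i> * \<theta> x + of_real \<epsilon> * pd j \<theta> x"

lemma packet_test:
  "\<theta> \<in> test_functions \<Longrightarrow> \<epsilon> > 0 \<Longrightarrow> packet \<kappa> i \<epsilon> \<theta> \<in> test_functions"
  unfolding packet_def
  by (intro test_functions_mult_smooth test_functions_scaled smooth_cmult smooth_cis) auto

lemma packet_pd_test: "\<theta> \<in> test_functions \<Longrightarrow> packet_pd \<kappa> i \<epsilon> j \<theta> \<in> test_functions"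
  unfolding packet_pd_def
  by (intro test_functions_add test_functions_cmult test_functions_pd)

text \<open>Together with \<open>norm_packet\<close> this reduces the norms of all derivatives of a
  packet to norms of envelopes, which are polynomials in \<epsilon> with fixed test functions as
  coefficients.\<close>

lemma pd_packet:
  assumes \<theta>: "\<theta> \<in> test_functions"
  shows "pd j (packet \<kappa> i \<epsilon> \<theta>) = packet \<kappa> i \<epsilon> (packet_pd \<kappa> i \<epsilon> j \<theta>)"
proof
  fix x :: "real ^ 'a"
  let ?c = "complex_of_real (sqrt (\<epsilon> ^ CARD('a)))"
  from pd_eqI[OF has_derivative_plane[OF has_vector_derivative_cis[of \<kappa> "x $ i"]], of j]
  have cis: "pd j (\<lambda>x. cis (\<kappa> * x $ i)) x = of_real (if j = i then \<kappa> else 0) * \<i> * cis (\<kappa> * x $ i)"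
    by (simp add: axis_def)
  have "pd j (packet \<kappa> i \<epsilon> \<theta>) x = pd j (\<lambda>x. ?c * cis (\<kappa> * x $ i)) x * \<theta> (\<epsilon> *\<^sub>R x)
      + ?c * cis (\<kappa> * x $ i) * pd j (\<lambda>x. \<theta> (\<epsilon> *\<^sub>R x)) x"
    unfolding packet_def
    by (intro pd_mult smooth_differentiable smooth_cmult smooth_cis smooth_scaled test_functionsD[OF \<theta>])
  also have "pd j (\<lambda>x. ?c * cis (\<kappa> * x $ i)) x = ?c * pd j (\<lambda>x. cis (\<kappa> * x $ i)) x"
    by (intro pd_cmult smooth_differentiable smooth_cis)
  also have "pd j (\<lambda>x. \<theta> (\<epsilon> *\<^sub>R x)) x = of_real \<epsilon> * pd j \<theta> (\<epsilon> *\<^sub>R x)"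
    by (intro pd_scaled smooth_differentiable test_functionsD[OF \<theta>])
  also have "?c * pd j (\<lambda>x. cis (\<kappa> * x $ i)) x * \<theta> (\<epsilon> *\<^sub>R x) + ?c * cis (\<kappa> * x $ i) * (of_real \<epsilon> * pd j \<theta> (\<epsilon> *\<^sub>R x))
      = packet \<kappa> i \<epsilon> (packet_pd \<kappa> i \<epsilon> j \<theta>) x"
    by (simp add: cis packet_def packet_pd_def algebra_simps)
  finally show "pd j (packet \<kappa> i \<epsilon> \<theta>) x = packet \<kappa> i \<epsilon> (packet_pd \<kappa> i \<epsilon> j \<theta>) x" .
qed

lemma norm_packet:
  fixes \<theta> :: "real ^ 'd::finite \<Rightarrow> complex"
  assumes \<theta>: "\<theta> \<in> test_functions" and "\<epsilon> > 0"
  shows "norm (abs_l2 (packet \<kappa> i \<epsilon> \<theta>)) = norm (abs_l2 \<theta>)"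
proof -
  have [measurable]: "\<theta> \<in> borel_measurable borel"
    by (intro smooth_measurable test_functionsD[OF \<theta>])
  have "(norm (abs_l2 \<theta>))\<^sup>2 = (\<integral>x. (cmod (\<theta> x))\<^sup>2 \<partial>lborel)"
    by (rule norm_abs_l2[OF test_functions_square_integrable[OF \<theta>]])
  also have "\<dots> = (\<integral>x. (cmod (\<theta> x))\<^sup>2 \<partial>density (distr lborel borel (\<lambda>x. 0 + \<epsilon> *\<^sub>R x)) (\<lambda>_. ennreal (\<epsilon> ^ CARD('d))))"
    using \<open>\<epsilon> > 0\<close> by (subst lborel_affine[of \<epsilon> 0]) simp_all
  also have "\<dots> = (\<integral>x. \<epsilon> ^ CARD('d) * (cmod (\<theta> (\<epsilon> *\<^sub>R x)))\<^sup>2 \<partial>lborel)"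
    using \<open>\<epsilon> > 0\<close> by (subst integral_density) (simp_all add: integral_distr)
  also have "\<dots> = (\<integral>x. (cmod (packet \<kappa> i \<epsilon> \<theta> x))\<^sup>2 \<partial>lborel)"
    using \<open>\<epsilon> > 0\<close> by (simp add: packet_def norm_mult power_mult_distrib)
  also have "\<dots> = (norm (abs_l2 (packet \<kappa> i \<epsilon> \<theta>)))\<^sup>2"
    by (rule norm_abs_l2[OF test_functions_square_integrable[OF packet_test[OF assms]], symmetric])
  finally show ?thesis by simp
qed

text \<open>Degree two is enough: two derivatives of the packet give a quadratic polynomial in
  \<epsilon>, and the third-order residual is quadratic once a factor \<epsilon> is taken
  out.\<close>

lemma norm_quadratic_tendsto:
  assumes "A \<in> test_functions" "B \<in> test_functions" "C \<in> test_functions" and \<epsilon>: "\<epsilon> \<longlonglongrightarrow> 0"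
  shows "(\<lambda>n. norm (abs_l2 (\<lambda>x. A x + of_real (\<epsilon> n) * B x + of_real ((\<epsilon> n)\<^sup>2) * C x)))
    \<longlonglongrightarrow> norm (abs_l2 A)"
proof -
  note si = assms(1-3)[THEN test_functions_square_integrable]
  have "(\<lambda>n. norm (abs_l2 A + \<epsilon> n *\<^sub>R abs_l2 B + (\<epsilon> n)\<^sup>2 *\<^sub>R abs_l2 C))
    \<longlonglongrightarrow> norm (abs_l2 A + 0 *\<^sub>R abs_l2 B + 0\<^sup>2 *\<^sub>R abs_l2 C)"
    by (intro tendsto_intros \<epsilon>)
  then show ?thesis
    using si by (simp add: abs_l2_add abs_l2_scaleR square_integrable_add square_integrable_cmult del: of_real_power)
qed

text \<open>
  The eigenfunctions are \<open>pd i (\<psi> n)\<close> instead of \<open>\<psi> n\<close> because a derivative has an obvious bound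
  in $\mathcal W^*$.
\<close>

lemma exists_approximate_eigenfunctions:
  fixes i :: "'d::finite"
  assumes "\<kappa> > 0"
  shows "\<exists>\<psi> N. N > 0 \<and> (\<forall>n. \<psi> n \<in> test_functions \<and> norm (abs_l2 (\<psi> n)) = N) \<and>
    (\<lambda>n. norm (abs_l2 (pd i (\<psi> n)))) \<longlonglongrightarrow> \<kappa> * N \<and>
    (\<lambda>n. norm (test_grad (pd i (\<psi> n)))) \<longlonglongrightarrow> \<kappa>\<^sup>2 * N \<and>
    (\<lambda>n. norm (laplace (pd i (\<psi> n)) + \<kappa>\<^sup>2 *\<^sub>R abs_l2 (pd i (\<psi> n)))) \<longlonglongrightarrow> 0"
proof -
  obtain \<eta> :: "real ^ 'd \<Rightarrow> complex" where \<eta>: "\<eta> \<in> test_functions" "abs_l2 \<eta> \<noteq> 0"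
    using exists_nonzero_test_function by blast
  define \<epsilon> where "\<epsilon> n = inverse (real (Suc n))" for n
  define N where "N = norm (abs_l2 \<eta>)"
  have \<epsilon>: "\<epsilon> n > 0" "\<epsilon> \<longlonglongrightarrow> 0" for n
    using LIMSEQ_inverse_real_of_nat by (simp_all add: \<epsilon>_def[abs_def])
  let ?p = "\<lambda>n. packet \<kappa> i (\<epsilon> n)" and ?P = "\<lambda>n. packet_pd \<kappa> i (\<epsilon> n)"
  define \<psi> where "\<psi> n = ?p n \<eta>" for n
  \<comment> \<open>The symbol of \<open>pd j\<close> on the plane wave: i\<kappa> in direction
    \<open>i\<close> and 0 otherwise, so that the squares of all \<open>a j\<close> add up to
    -\<kappa>^2.\<close>
  define a where "a j = of_real (if j = i then \<kappa> else 0) * \<i>" for j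
  note si = test_functions_square_integrable
  note tests = test_functions_add test_functions_cmult test_functions_pd \<eta>(1)
  have pd_lin: "pd j (\<lambda>x. c * f x + d * g x) = (\<lambda>x. c * pd j f x + d * pd j g x)"
    if "f \<in> test_functions" "g \<in> test_functions" for j c d and f g :: "real ^ 'd \<Rightarrow> complex"
    using that[THEN test_functionsD(1)]
    by (auto simp: pd_add pd_cmult smooth_differentiable smooth_cmult)
  have P1: "?P n j \<theta> = (\<lambda>x. a j * \<theta> x + of_real (\<epsilon> n) * pd j \<theta> x)" for n j \<theta>
    by (simp add: packet_pd_def a_def fun_eq_iff)
  have pdf: "pd i (\<psi> n) = ?p n (?P n i \<eta>)" for n
    by (simp add: \<psi>_def pd_packet \<eta>)
  have pdf2: "pd j (pd i (\<psi> n)) = ?p n (?P n j (?P n i \<eta>))" for n j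
    by (simp add: pdf pd_packet packet_pd_test \<eta>)
  have pdf3: "pd j (pd j (pd i (\<psi> n))) = ?p n (?P n j (?P n j (?P n i \<eta>)))" for n j
    by (simp add: pdf pd_packet packet_pd_test \<eta>)
  have P2: "?P n j (?P n i \<eta>) = (\<lambda>x. a j * a i * \<eta> x + of_real (\<epsilon> n) * (a j * pd i \<eta> x + a i * pd j \<eta> x)
      + of_real ((\<epsilon> n)\<^sup>2) * pd j (pd i \<eta>) x)" for n j
    unfolding P1 pd_lin[OF \<eta>(1) test_functions_pd[OF \<eta>(1)]]
    by (simp add: fun_eq_iff power2_eq_square algebra_simps)
  \<comment> \<open>Subtracting the square of the symbol removes the terms of order 0 in \<epsilon>;
    this cancellation is what makes the residual vanish in the limit.\<close>
  have P3: "?P n j (?P n j (?P n i \<eta>)) x - a j * a j * ?P n i \<eta> x = of_real (\<epsilon> n) *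
      (2 * a j * a i * pd j \<eta> x + of_real (\<epsilon> n) * (a i * pd j (pd j \<eta>) x + 2 * a j * pd j (pd i \<eta>) x)
      + of_real ((\<epsilon> n)\<^sup>2) * pd j (pd j (pd i \<eta>)) x)" for n j x
    unfolding P1 pd_lin[OF \<eta>(1) test_functions_pd[OF \<eta>(1)]]
      pd_lin[OF test_functions_add[OF test_functions_cmult[OF \<eta>(1)] test_functions_cmult[OF test_functions_pd[OF \<eta>(1)]]]
        test_functions_add[OF test_functions_cmult[OF test_functions_pd[OF \<eta>(1)]] test_functions_cmult[OF test_functions_pd[OF test_functions_pd[OF \<eta>(1)]]]]]
      pd_lin[OF test_functions_pd[OF \<eta>(1)] test_functions_pd[OF test_functions_pd[OF \<eta>(1)]]]
    by (simp add: power2_eq_square algebra_simps)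
  have \<psi>: "\<psi> n \<in> test_functions" for n
    unfolding \<psi>_def using \<epsilon> by (intro packet_test \<eta>)
  have norm_f: "norm (abs_l2 (pd i (\<psi> n))) = norm (abs_l2 (?P n i \<eta>))" for n
    unfolding pdf by (rule norm_packet[OF packet_pd_test[OF \<eta>(1)] \<epsilon>(1)])
  \<comment> \<open>A single derivative is linear in \<epsilon>; the zero summand fits it to the
    quadratic form.\<close>
  have "(\<lambda>n. norm (abs_l2 (\<lambda>x. a i * \<eta> x + of_real (\<epsilon> n) * pd i \<eta> x + of_real ((\<epsilon> n)\<^sup>2) * (0 * \<eta> x))))
    \<longlonglongrightarrow> norm (abs_l2 (\<lambda>x. a i * \<eta> x))"
    by (intro norm_quadratic_tendsto tests \<epsilon>)
  then have lim_f: "(\<lambda>n. norm (abs_l2 (pd i (\<psi> n)))) \<longlonglongrightarrow> \<kappa> * N"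
    using \<open>\<kappa> > 0\<close>
    unfolding norm_f P1 by (simp add: abs_l2_cmult[OF si[OF \<eta>(1)]] norm_scaleC_l2 norm_mult a_def N_def)
  have norm_pd_f: "norm (abs_l2 (pd j (pd i (\<psi> n)))) = norm (abs_l2 (?P n j (?P n i \<eta>)))" for n j
    unfolding pdf2 by (rule norm_packet[OF packet_pd_test[OF packet_pd_test[OF \<eta>(1)]] \<epsilon>(1)])
  have lim_pd_f: "(\<lambda>n. norm (abs_l2 (pd j (pd i (\<psi> n))))) \<longlonglongrightarrow> norm (abs_l2 (\<lambda>x. a j * a i * \<eta> x))" for j
    unfolding norm_pd_f P2
    by (intro norm_quadratic_tendsto tests \<epsilon>)
  have "(\<lambda>n. sqrt (\<Sum>j\<in>UNIV. (norm (abs_l2 (pd j (pd i (\<psi> n)))))\<^sup>2))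
    \<longlonglongrightarrow> sqrt (\<Sum>j\<in>UNIV. (norm (abs_l2 (\<lambda>x. a j * a i * \<eta> x)))\<^sup>2)"
    by (intro tendsto_real_sqrt tendsto_sum tendsto_power lim_pd_f)
  \<comment> \<open>In the limit only the component in direction \<open>i\<close> survives, as
    \<open>a j\<close> is 0 for the others.\<close>
  moreover have "(\<Sum>j\<in>UNIV. (norm (abs_l2 (\<lambda>x. a j * a i * \<eta> x)))\<^sup>2) = (\<Sum>j\<in>UNIV. if j = i then (\<kappa>\<^sup>2 * N)\<^sup>2 else 0)"
    using \<open>\<kappa> > 0\<close> by (intro sum.cong)
      (auto simp: abs_l2_cmult[OF si[OF \<eta>(1)]] norm_scaleC_l2 norm_mult a_def N_def power2_eq_square)
  ultimately have lim_grad: "(\<lambda>n. norm (test_grad (pd i (\<psi> n)))) \<longlonglongrightarrow> \<kappa>\<^sup>2 * N"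
    by (simp add: norm_vec_def L2_set_def test_grad_def N_def)
  define Q where "Q n j = (\<lambda>x. 2 * a j * a i * pd j \<eta> x + of_real (\<epsilon> n) * (a i * pd j (pd j \<eta>) x + 2 * a j * pd j (pd i \<eta>) x)
      + of_real ((\<epsilon> n)\<^sup>2) * pd j (pd j (pd i \<eta>)) x)" for n j
  have Q: "Q n j \<in> test_functions" for n j
    unfolding Q_def by (intro tests)
  have lim_Q: "(\<lambda>n. norm (abs_l2 (Q n j))) \<longlonglongrightarrow> norm (abs_l2 (\<lambda>x. 2 * a j * a i * pd j \<eta> x))" for j
    unfolding Q_def by (intro norm_quadratic_tendsto tests \<epsilon>)
  have "(\<lambda>n. \<Sum>j\<in>UNIV. \<epsilon> n * norm (abs_l2 (Q n j)))
    \<longlonglongrightarrow> (\<Sum>j\<in>UNIV. 0 * norm (abs_l2 (\<lambda>x. 2 * a j * a i * pd j \<eta> x)))"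
    by (intro tendsto_sum tendsto_mult lim_Q \<epsilon>)
  then have lim0: "(\<lambda>n. \<Sum>j\<in>UNIV. \<epsilon> n * norm (abs_l2 (Q n j))) \<longlonglongrightarrow> 0" by simp
  have res: "norm (laplace (pd i (\<psi> n)) + \<kappa>\<^sup>2 *\<^sub>R abs_l2 (pd i (\<psi> n))) \<le> (\<Sum>j\<in>UNIV. \<epsilon> n * norm (abs_l2 (Q n j)))" for n
  proof -
    \<comment> \<open>\<open>?b\<close> assigns all of \<kappa>^2 to the direction \<open>i\<close>,
      so the residual splits into one term for each direction, to which \<open>P3\<close>
      applies.\<close>
    let ?f = "pd i (\<psi> n)" and ?b = "\<lambda>j. if j = i then \<kappa>\<^sup>2 else 0"
    have f: "?f \<in> test_functions" by (rule test_functions_pd[OF \<psi>])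
    have "pd j (pd j ?f) x + of_real (?b j) * ?f x = of_real (\<epsilon> n) * ?p n (Q n j) x" for j x
    proof -
      have "of_real (?b j) = - (a j * a j)"
        by (auto simp: a_def power2_eq_square algebra_simps)
      then have "pd j (pd j ?f) x + of_real (?b j) * ?f x
          = ?p n (\<lambda>x. ?P n j (?P n j (?P n i \<eta>)) x - a j * a j * ?P n i \<eta> x) x"
        by (simp add: pdf3) (simp add: pdf packet_def algebra_simps)
      then show ?thesis unfolding P3 by (simp add: Q_def packet_def algebra_simps)
    qed
    then have "(\<lambda>x. pd j (pd j ?f) x + of_real (?b j) * ?f x) = (\<lambda>x. of_real (\<epsilon> n) * ?p n (Q n j) x)" for j
      by blast
    then have "abs_l2 (\<lambda>x. pd j (pd j ?f) x + of_real (?b j) * ?f x) = abs_l2 (\<lambda>x. of_real (\<epsilon> n) * ?p n (Q n j) x)" for j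
      by (rule arg_cong)
    then have j: "abs_l2 (pd j (pd j ?f)) + ?b j *\<^sub>R abs_l2 ?f = \<epsilon> n *\<^sub>R abs_l2 (?p n (Q n j))" for j
      using f \<epsilon>(1) Q by (simp only: abs_l2_add abs_l2_scaleR si test_functions_pd test_functions_cmult packet_test)
    have "\<kappa>\<^sup>2 *\<^sub>R abs_l2 ?f = (\<Sum>j\<in>UNIV. ?b j *\<^sub>R abs_l2 ?f)"
      by (simp flip: scaleR_sum_left)
    then have "laplace ?f + \<kappa>\<^sup>2 *\<^sub>R abs_l2 ?f = (\<Sum>j\<in>UNIV. \<epsilon> n *\<^sub>R abs_l2 (?p n (Q n j)))"
      by (simp only: laplace_def j flip: sum.distrib)
    also have "norm \<dots> \<le> (\<Sum>j\<in>UNIV. \<epsilon> n * norm (abs_l2 (Q n j)))"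
      using \<epsilon>(1)[of n] by (intro order_trans[OF norm_sum]) (simp add: norm_packet Q)
    finally show ?thesis .
  qed
  have "(\<lambda>n. norm (laplace (pd i (\<psi> n)) + \<kappa>\<^sup>2 *\<^sub>R abs_l2 (pd i (\<psi> n)))) \<longlonglongrightarrow> 0"
    by (rule tendsto_sandwich[OF _ _ tendsto_const lim0]) (simp_all add: res)
  moreover have "N > 0" "norm (abs_l2 (\<psi> n)) = N" for n
    using \<eta> \<epsilon>(1) by (simp_all add: N_def \<psi>_def norm_packet)
  ultimately show ?thesis
    using \<psi> lim_f lim_grad by (intro exI[of _ \<psi>] exI[of _ N]) simp
qed

text \<open>The limit along the packets at fixed time and frequency. The error terms vanish, and
  what is left is homogeneous in the common norm \<open>N\<close> of the packets.\<close>

lemma decay_rates_ge: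
  fixes T :: "real \<Rightarrow> 'd::finite energy \<Rightarrow> 'd energy"
  assumes gen: "generates energy_space wave_operator T"
    and \<mu>: "\<mu>\<^sup>2 + \<mu> + \<kappa>\<^sup>2 = 0" "\<mu> \<le> 0" and \<kappa>: "\<kappa> > 0" and t: "t > 0"
    and r: "r0 \<ge> 0" "r1 \<ge> 0" "r2 \<ge> 0"
    and r0: "\<And>F. F \<in> K_space \<Longrightarrow> L2_norm_le (mild_solution T F t) (r0 * K_norm F)"
    and r1: "\<And>F. F \<in> K_space \<Longrightarrow> norm (mild_solution T F t) \<le> r1 * K_norm F"
    and r2: "\<And>F. F \<in> K_space \<Longrightarrow> norm (mild_solution_dt T F t) \<le> r2 * K_norm F"
  defines "M \<equiv> sqrt ((\<kappa>\<^sup>2)\<^sup>2 + (\<mu>\<^sup>2 + 1) * \<kappa>\<^sup>2 + (1 + \<mu>)\<^sup>2)"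
  shows "exp (\<mu> * t) * \<kappa> \<le> r0 * M" and "exp (\<mu> * t) * \<kappa>\<^sup>2 \<le> r1 * M"
    and "exp (\<mu> * t) * (- \<mu> * \<kappa>) \<le> r2 * M"
proof -
  obtain i :: 'd where True by simp
  obtain \<psi> N where N: "N > 0" and \<psi>: "\<And>n. \<psi> n \<in> test_functions" "\<And>n. norm (abs_l2 (\<psi> n)) = N"
    and l: "(\<lambda>n. norm (abs_l2 (pd i (\<psi> n)))) \<longlonglongrightarrow> \<kappa> * N"
      "(\<lambda>n. norm (test_grad (pd i (\<psi> n)))) \<longlonglongrightarrow> \<kappa>\<^sup>2 * N"
      "(\<lambda>n. norm (laplace (pd i (\<psi> n)) + \<kappa>\<^sup>2 *\<^sub>R abs_l2 (pd i (\<psi> n)))) \<longlonglongrightarrow> 0"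
    using exists_approximate_eigenfunctions[OF \<kappa>, of i] by blast
  note ge = decay_rates_ge_approximate[OF gen \<mu> t r r0 r1 r2 \<psi>(1), where i = i, unfolded \<psi>(2)]
  have M: "sqrt ((\<kappa>\<^sup>2 * N)\<^sup>2 + (\<mu>\<^sup>2 + 1) * (\<kappa> * N)\<^sup>2 + ((1 + \<mu>) * N)\<^sup>2) = M * N"
  proof -
    have "(\<kappa>\<^sup>2 * N)\<^sup>2 + (\<mu>\<^sup>2 + 1) * (\<kappa> * N)\<^sup>2 + ((1 + \<mu>) * N)\<^sup>2
        = ((\<kappa>\<^sup>2)\<^sup>2 + (\<mu>\<^sup>2 + 1) * \<kappa>\<^sup>2 + (1 + \<mu>)\<^sup>2) * N\<^sup>2"
      by (simp add: power2_eq_square algebra_simps)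
    then show ?thesis using N by (simp add: M_def real_sqrt_mult)
  qed
  define X where "X n = norm (abs_l2 (pd i (\<psi> n)))" for n
  define Y where "Y n = norm (test_grad (pd i (\<psi> n)))" for n
  define Z where "Z n = norm (laplace (pd i (\<psi> n)) + \<kappa>\<^sup>2 *\<^sub>R abs_l2 (pd i (\<psi> n)))" for n
  define K where "K n = sqrt ((Y n)\<^sup>2 + (\<mu>\<^sup>2 + 1) * (X n)\<^sup>2 + ((1 + \<mu>) * N)\<^sup>2)" for n
  note ge = ge[folded X_def Y_def Z_def, folded K_def]
  note l = l[folded X_def Y_def Z_def]
  have K: "K \<longlonglongrightarrow> M * N"
    unfolding M[symmetric] K_def by (intro tendsto_intros l)
  have "exp (\<mu> * t) * (\<kappa> * N)\<^sup>2 - t * 0 * N \<le> r0 * (M * N) * (\<kappa> * N)"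
    by (rule LIMSEQ_le[where X = "\<lambda>n. exp (\<mu> * t) * (X n)\<^sup>2 - t * Z n * N" and Y = "\<lambda>n. r0 * K n * X n"])
      (intro tendsto_intros l K exI allI impI ge)+
  \<comment> \<open>The estimate by duality is quadratic in the packet, hence \<kappa> N^2 cancels
    here, compared with N in the two estimates below.\<close>
  then have "(exp (\<mu> * t) * \<kappa>) * (\<kappa> * N\<^sup>2) \<le> (r0 * M) * (\<kappa> * N\<^sup>2)"
    by (simp add: power2_eq_square algebra_simps)
  then show "exp (\<mu> * t) * \<kappa> \<le> r0 * M"
    using N \<kappa> by (subst (asm) mult_le_cancel_right_pos) auto
  have "exp (\<mu> * t) * (\<kappa>\<^sup>2 * N) - t * 0 \<le> r1 * (M * N)"
    by (rule LIMSEQ_le[where X = "\<lambda>n. exp (\<mu> * t) * Y n - t * Z n" and Y = "\<lambda>n. r1 * K n"])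
      (intro tendsto_intros l K exI allI impI ge)+
  then have "(exp (\<mu> * t) * \<kappa>\<^sup>2) * N \<le> (r1 * M) * N" by (simp add: algebra_simps)
  then show "exp (\<mu> * t) * \<kappa>\<^sup>2 \<le> r1 * M"
    using N by (subst (asm) mult_le_cancel_right_pos) auto
  have "exp (\<mu> * t) * (- \<mu> * (\<kappa> * N)) - t * 0 \<le> r2 * (M * N)"
    by (rule LIMSEQ_le[where X = "\<lambda>n. exp (\<mu> * t) * (- \<mu> * X n) - t * Z n" and Y = "\<lambda>n. r2 * K n"])
      (intro tendsto_intros l K exI allI impI ge)+
  then have "(exp (\<mu> * t) * (- \<mu> * \<kappa>)) * N \<le> (r2 * M) * N" by (simp add: algebra_simps)
  then show "exp (\<mu> * t) * (- \<mu> * \<kappa>) \<le> r2 * M"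
    using N by (subst (asm) mult_le_cancel_right_pos) auto
qed

section \<open>The decay constants\<close>

text \<open>The substitution y = 2s/(j+1) moves the maximiser to y = 1. There the claim is the
  (j+1)-th power of y e^(-y) \<le> e^(-1), which is the tangent line inequality y \<le>
  e^(y-1).\<close>

lemma power_exp_le_maximum:
  fixes s :: real
  assumes "s \<ge> 0"
  shows "s ^ (j + 1) * exp (- 2 * s) \<le> ((real j + 1) / (2 * exp 1)) ^ (j + 1)"
proof -
  let ?k = "real j + 1"
  define y where "y = 2 * s / ?k"
  have "y \<le> exp (y - 1)"
    using exp_ge_add_one_self[of "y - 1"] by simp
  then have "y * exp (- y) \<le> exp (y - 1) * exp (- y)"
    by (rule mult_right_mono) simp
  also have "exp (y - 1) * exp (- y) = exp (- 1)"
    unfolding exp_add[symmetric] by simp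
  finally have "y * exp (- y) \<le> exp (- 1)" .
  then have "?k / 2 * (y * exp (- y)) \<le> ?k / 2 * exp (- 1)"
    by (rule mult_left_mono) simp
  moreover have ky: "?k / 2 * y = s"
    using of_nat_0_le_iff[of j, where 'a=real] unfolding y_def by (simp add: field_simps)
  moreover have "?k / 2 * exp (- 1) = ?k / (2 * exp 1)"
    by (simp only: exp_minus divide_inverse inverse_mult_distrib mult_ac)
  ultimately have "s * exp (- y) \<le> ?k / (2 * exp 1)"
    by (simp only: mult.assoc[symmetric])
  then have "(s * exp (- y)) ^ (j + 1) \<le> (?k / (2 * exp 1)) ^ (j + 1)"
    using assms by (intro power_mono) auto
  also have "(s * exp (- y)) ^ (j + 1) = s ^ (j + 1) * exp (real (j + 1) * (- y))"
    by (simp only: power_mult_distrib exp_of_nat_mult)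
  also have "real (j + 1) * (- y) = - 2 * s"
    using ky by (simp add: field_simps)
  finally show ?thesis .
qed

lemma decay_const_eq:
  "decay_const j = ((real j + 1) / (2 * exp 1)) powr ((real j + 1) / 2)"
proof -
  let ?A = "(real j + 1) / (2 * exp 1)"
  have A: "?A > 0" by simp
  have "(SUP s\<in>{0..}. s ^ (j + 1) * exp (- 2 * s)) = ?A ^ (j + 1)"
  proof (rule cSup_eq_maximum)
    have "?A = (real j + 1) / 2 * exp (- 1)"
      by (simp only: exp_minus divide_inverse inverse_mult_distrib mult_ac)
    moreover have "exp (- 2 * ((real j + 1) / 2)) = exp (- 1) ^ (j + 1)"
      by (simp only: exp_of_nat_mult[symmetric]) simp
    ultimately have "((real j + 1) / 2) ^ (j + 1) * exp (- 2 * ((real j + 1) / 2)) = ?A ^ (j + 1)"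
      by (simp only: power_mult_distrib)
    then show "?A ^ (j + 1) \<in> (\<lambda>s. s ^ (j + 1) * exp (- 2 * s)) ` {0..}"
      by (intro image_eqI[of _ _ "(real j + 1) / 2"]) auto
  qed (auto intro: power_exp_le_maximum[simplified])
  then have "decay_const j = sqrt (?A powr (real (j + 1)))"
    unfolding decay_const_def using A by (simp only: powr_realpow)
  also have "\<dots> = ?A powr ((real j + 1) / 2)"
    using A by (simp add: powr_half_sqrt[symmetric] powr_powr add.commute)
  finally show ?thesis .
qed

text \<open>The form in which the constant appears as a limit: at \<kappa>^2 = s/t the power
  \<kappa>^(j+1) t^((j+1)/2) equals s^s, and e^(\<mu> t) tends to e^(-s).\<close>

lemma decay_const_eq_exp:
  assumes "s = (real j + 1) / 2"
  shows "decay_const j = s powr s * exp (- s)"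
proof -
  have "(real j + 1) / (2 * exp 1) = s * exp (- 1)"
    by (simp only: assms exp_minus divide_inverse inverse_mult_distrib mult_ac)
  then have "decay_const j = (s * exp (- 1)) powr s"
    by (simp only: decay_const_eq assms)
  moreover have "s \<ge> 0"
    using assms by simp
  then have "(s * exp (- 1)) powr s = s powr s * exp (- s)"
    by (simp add: powr_mult exp_powr_real)
  ultimately show ?thesis by (simp only:)
qed

section \<open>The slow eigenvalue and the limits for large times\<close>

definition slow_eigenvalue :: "real \<Rightarrow> real" where
  "slow_eigenvalue k = (sqrt (1 - 4 * k) - 1) / 2"

text \<open>The upper bound on \<open>k\<close> keeps the root real. For small \<open>k\<close> the
  root is -k - k^2 + O(k^3); after multiplication by t at k = s/t, everything but -s tends to
  0.\<close>

lemma slow_eigenvalue: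
  assumes "0 \<le> k" "k \<le> 1 / 4"
  shows "(slow_eigenvalue k)\<^sup>2 + slow_eigenvalue k + k = 0" "slow_eigenvalue k \<le> 0"
  using assms by (auto simp: slow_eigenvalue_def power2_eq_square field_simps)

text \<open>For $k=\kappa^2$, the limit of $\|F\|_{\mathcal K}/\|\psi\|$ along the wave packets.\<close>

definition energy_factor :: "real \<Rightarrow> real" where
  "energy_factor k = sqrt (k\<^sup>2 + ((slow_eigenvalue k)\<^sup>2 + 1) * k + (1 + slow_eigenvalue k)\<^sup>2)"

text \<open>The argument is s/t with s = (j+1)/2 at j = 0; the next two limits use s = 1 and s =
  3/2. The energy factor tends to 1, its surviving part being the bound on the dual norm.\<close>

lemma asymptotics_0:
  "((\<lambda>t. sqrt t * (exp (slow_eigenvalue (1 / 2 / t) * t) * sqrt (1 / 2 / t)) / energy_factor (1 / 2 / t))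
    \<longlongrightarrow> decay_const 0) at_top"
proof -
  have "decay_const 0 = (1 / 2) powr (1 / 2) * exp (- (1 / 2))"
    using decay_const_eq_exp[of "1 / 2" 0] by simp
  then show ?thesis
    unfolding energy_factor_def slow_eigenvalue_def by (simp only:) real_asymp
qed

lemma asymptotics_1:
  "((\<lambda>t. t * (exp (slow_eigenvalue (1 / t) * t) * (1 / t)) / energy_factor (1 / t))
    \<longlongrightarrow> decay_const 1) at_top"
proof -
  have "decay_const 1 = exp (- 1)"
    using decay_const_eq_exp[of "1" 1] by simp
  then show ?thesis
    unfolding energy_factor_def slow_eigenvalue_def by (simp only:) real_asymp
qed

text \<open>The time derivative brings the factor -\<mu>, which is asymptotic to \<open>k\<close>,
  so the amplitude is of order k^(3/2).\<close>

lemma asymptotics_2: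
  "((\<lambda>t. t powr (3 / 2) * (exp (slow_eigenvalue (3 / 2 / t) * t) * (- slow_eigenvalue (3 / 2 / t) * sqrt (3 / 2 / t)))
    / energy_factor (3 / 2 / t)) \<longlongrightarrow> decay_const 2) at_top"
proof -
  have "decay_const 2 = 3 / 2 * (3 / 2) powr (1 / 2) * exp (- (3 / 2))"
    using decay_const_eq_exp[of "3 / 2" 2] powr_add[of "3 / 2 :: real" 1 "1 / 2"] by simp
  then show ?thesis
    unfolding energy_factor_def slow_eigenvalue_def by (simp only:) real_asymp
qed

text \<open>Here \<open>k\<close> and \<open>t\<close> are still independent of each other, so one
  inequality serves for three different choices of the frequency.\<close>

lemma decay_rates_asymptotic:
  fixes T :: "real \<Rightarrow> 'd::finite energy \<Rightarrow> 'd energy"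
    and \<rho>0 \<rho>1 \<rho>2 :: "real \<Rightarrow> real"
  assumes gen: "generates energy_space wave_operator T"
    and r: "\<rho>0 \<in> {0..} \<rightarrow> {0..}" "\<rho>1 \<in> {0..} \<rightarrow> {0..}" "\<rho>2 \<in> {0..} \<rightarrow> {0..}"
    and r0: "\<And>F t. F \<in> K_space \<Longrightarrow> t > 0 \<Longrightarrow> L2_norm_le (mild_solution T F t) (\<rho>0 t * K_norm F)"
    and r1: "\<And>F t. F \<in> K_space \<Longrightarrow> t > 0 \<Longrightarrow> norm (mild_solution T F t) \<le> \<rho>1 t * K_norm F"
    and r2: "\<And>F t. F \<in> K_space \<Longrightarrow> t > 0 \<Longrightarrow> norm (mild_solution_dt T F t) \<le> \<rho>2 t * K_norm F"
    and k: "0 < k" "k \<le> 1 / 4" and t: "t > 0"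
  shows "exp (slow_eigenvalue k * t) * sqrt k / energy_factor k \<le> \<rho>0 t"
    and "exp (slow_eigenvalue k * t) * k / energy_factor k \<le> \<rho>1 t"
    and "exp (slow_eigenvalue k * t) * (- slow_eigenvalue k * sqrt k) / energy_factor k \<le> \<rho>2 t"
proof -
  have "\<rho>0 t \<ge> 0" "\<rho>1 t \<ge> 0" "\<rho>2 t \<ge> 0"
    using r t by (auto simp: Pi_iff)
  moreover have "(sqrt k)\<^sup>2 = k" "sqrt k > 0"
    using k by simp_all
  moreover have E: "energy_factor k > 0"
    unfolding energy_factor_def using k
    by (intro real_sqrt_gt_zero add_pos_nonneg add_nonneg_pos mult_pos_pos) auto
  ultimately show "exp (slow_eigenvalue k * t) * sqrt k / energy_factor k \<le> \<rho>0 t"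
    and "exp (slow_eigenvalue k * t) * k / energy_factor k \<le> \<rho>1 t"
    and "exp (slow_eigenvalue k * t) * (- slow_eigenvalue k * sqrt k) / energy_factor k \<le> \<rho>2 t"
    unfolding pos_divide_le_eq[OF E]
    using decay_rates_ge[OF gen, of "slow_eigenvalue k" "sqrt k" t "\<rho>0 t" "\<rho>1 t" "\<rho>2 t"]
      slow_eigenvalue[of k] k t r0 r1 r2
    by (simp_all add: energy_factor_def)
qed

theorem proposition6p1:
  fixes T :: "real \<Rightarrow> 'd::finite energy \<Rightarrow> 'd energy"
    and \<rho>0 \<rho>1 \<rho>2 :: "real \<Rightarrow> real"
  assumes "generates energy_space wave_operator T"
    and "\<rho>0 \<in> {0..} \<rightarrow> {0..}" and "\<rho>1 \<in> {0..} \<rightarrow> {0..}" and "\<rho>2 \<in> {0..} \<rightarrow> {0..}"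
    and "\<And>F t. F \<in> K_space \<Longrightarrow> t > 0 \<Longrightarrow> L2_norm_le (mild_solution T F t) (\<rho>0 t * K_norm F)"
    and "\<And>F t. F \<in> K_space \<Longrightarrow> t > 0 \<Longrightarrow> norm (mild_solution T F t) \<le> \<rho>1 t * K_norm F"
    and "\<And>F t. F \<in> K_space \<Longrightarrow> t > 0 \<Longrightarrow> norm (mild_solution_dt T F t) \<le> \<rho>2 t * K_norm F"
  shows "(\<forall>j\<in>{0, 1, 2}. decay_const j = ((real j + 1) / (2 * exp 1)) powr ((real j + 1) / 2)) \<and>
    (\<forall>\<epsilon>>0. \<exists>t0\<ge>1. \<forall>t\<ge>t0.
       \<rho>0 t \<ge> (decay_const 0 - \<epsilon>) / sqrt t \<and>
       \<rho>1 t \<ge> (decay_const 1 - \<epsilon>) / t \<and>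
       \<rho>2 t \<ge> (decay_const 2 - \<epsilon>) / t powr (3 / 2))"
proof (intro conjI ballI allI impI)
  show "decay_const j = ((real j + 1) / (2 * exp 1)) powr ((real j + 1) / 2)" for j
    by (rule decay_const_eq)
  fix \<epsilon> :: real assume "\<epsilon> > 0"
  note ge = decay_rates_asymptotic[OF assms]
  \<comment> \<open>From t = 6 on, the largest of the three values of \<open>k\<close>, namely
    3/(2t), is at most 1/4.\<close>
  have "eventually (\<lambda>t::real. t \<ge> 6) at_top"
    by (rule eventually_ge_at_top)
  moreover have "eventually (\<lambda>t. decay_const 0 - \<epsilon> < sqrt t * (exp (slow_eigenvalue (1 / 2 / t) * t) * sqrt (1 / 2 / t)) / energy_factor (1 / 2 / t)) at_top"
    using \<open>\<epsilon> > 0\<close> by (intro order_tendstoD(1)[OF asymptotics_0]) simp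
  moreover have "eventually (\<lambda>t. decay_const 1 - \<epsilon> < t * (exp (slow_eigenvalue (1 / t) * t) * (1 / t)) / energy_factor (1 / t)) at_top"
    using \<open>\<epsilon> > 0\<close> by (intro order_tendstoD(1)[OF asymptotics_1]) simp
  moreover have "eventually (\<lambda>t. decay_const 2 - \<epsilon> < t powr (3 / 2) * (exp (slow_eigenvalue (3 / 2 / t) * t) * (- slow_eigenvalue (3 / 2 / t) * sqrt (3 / 2 / t)))
    / energy_factor (3 / 2 / t)) at_top"
    using \<open>\<epsilon> > 0\<close> by (intro order_tendstoD(1)[OF asymptotics_2]) simp
  ultimately have "eventually (\<lambda>t. \<rho>0 t \<ge> (decay_const 0 - \<epsilon>) / sqrt t \<and>
       \<rho>1 t \<ge> (decay_const 1 - \<epsilon>) / t \<and> \<rho>2 t \<ge> (decay_const 2 - \<epsilon>) / t powr (3 / 2)) at_top"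
  proof eventually_elim
    case (elim t)
    have bound: "a / p \<le> \<rho>" if "a < p * e / m" "e / m \<le> \<rho>" "p > 0" for a p e m \<rho> :: real
    proof -
      have "a \<le> p * (e / m)" using that(1) by simp
      also have "\<dots> \<le> p * \<rho>" using that by (intro mult_left_mono) auto
      finally show ?thesis using that(3) by (simp add: pos_divide_le_eq mult.commute)
    qed
    have "1 / 2 / t \<le> 1 / 4" "1 / t \<le> 1 / 4" "3 / 2 / t \<le> 1 / 4"
      using elim(1) by (simp_all add: field_simps)
    with elim show ?case
      by (intro conjI bound[OF elim(2) ge(1)] bound[OF elim(3) ge(2)] bound[OF elim(4) ge(3)]) auto
  qed
  then obtain t0 where "\<forall>t\<ge>t0. \<rho>0 t \<ge> (decay_const 0 - \<epsilon>) / sqrt t \<and>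
       \<rho>1 t \<ge> (decay_const 1 - \<epsilon>) / t \<and> \<rho>2 t \<ge> (decay_const 2 - \<epsilon>) / t powr (3 / 2)"
    by (auto simp: eventually_at_top_linorder)
  then show "\<exists>t0\<ge>1. \<forall>t\<ge>t0. \<rho>0 t \<ge> (decay_const 0 - \<epsilon>) / sqrt t \<and>
       \<rho>1 t \<ge> (decay_const 1 - \<epsilon>) / t \<and> \<rho>2 t \<ge> (decay_const 2 - \<epsilon>) / t powr (3 / 2)"
    by (intro exI[of _ "max 1 t0"]) simp
qed

end
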